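(* Let $\mu\in(0,\infty)$ be a fixed number and let $T\sim F_T$ be a nonnegative random variable. Then $$0\le \mathsf{E}[T]<1$$ if and only if the functional equation (of compound-exponential type) $$\hat F(s)=\frac{1}{1+\sigma(s)},\quad s\ge 0,$$ has exactly one solution $X\sim F$ (a distribution $F$ of a nonnegative random variable $X$) with mean $\mu$ and finite variance. Moreover, in this case, $$\mathsf{Var}[X]=\frac{1+\mathsf{E}[T]}{1-\mathsf{E}[T]}\,\mu^2 .$$
   Context: For a nonnegative random variable $Y$, $Y\sim F_Y$ means that $Y$ has distribution function $F_Y$, and $\hat F_Y(s)=\mathsf{E}[e^{-sY}]=\int_0^\infty e^{-sy}\,\mathrm{d}F_Y(y)$, $s\ge0$, is its Laplace–Stieltjes transform. Integrals $\int_0^\infty$ with respect to distributions include a possible atom at $0$. For a distribution $F$ on $[0,\infty)$ with mean $\mu\in(0,\infty)$ (the unknown of the equation), define $$\sigma(s)=\int_0^\infty\frac{1-\hat F(ts)}{t}\,\mathrm{d}F_T(t),\quad s\ge0,$$ where the integrand at $t=0$ is defined by continuity to be $\mu s$. Equivalently, $\sigma(s)=\mu\int_0^s\hat F_{TZ}(x)\,\mathrm{d}x$, where $Z$ is independent of $T$ and has the length-biased distribution $F_Z(z)=\frac1\mu\int_0^z x\,\mathrm{d}F(x)$, $z\ge0$. Note that $\sigma$ depends on the unknown $F$. *)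

theory Defs
  imports "HOL-Probability.Probability"
begin

text \<open>
  A distribution on \<open>[0, \<infinity>)\<close> is represented by its law, a Borel probability measure on the reals
  that gives no mass to the negative half-line. Integrals with respect to \<open>F\<close> therefore
  include a possible atom at \<open>0\<close>.
\<close>

definition nonneg_distribution :: "real measure \<Rightarrow> bool" where
  "nonneg_distribution F \<longleftrightarrow> real_distribution F \<and> (AE x in F. 0 \<le> x)"

definition laplace_stieltjes :: "real measure \<Rightarrow> real \<Rightarrow> real" where
  "laplace_stieltjes F s = (\<integral>x. exp (- s * x) \<partial>F)"

text \<open>
  The value of the integrand at \<open>t = 0\<close> is its limit for \<open>t \<rightarrow> 0+\<close>, namely the mean of \<open>F\<close> times \<open>s\<close>.
  If \<open>F\<close> has a finite mean, the integrand lies between \<open>0\<close> and that value for all \<open>s, t \<ge> 0\<close>,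
  so the integral is finite.
\<close>

definition sigma :: "real measure \<Rightarrow> real measure \<Rightarrow> real \<Rightarrow> real" where
  "sigma FT F s =
     (\<integral>t. (if t = 0 then (\<integral>x. x \<partial>F) * s else (1 - laplace_stieltjes F (t * s)) / t) \<partial>FT)"

definition has_mean :: "real measure \<Rightarrow> real \<Rightarrow> bool" where
  "has_mean F \<mu> \<longleftrightarrow> integrable F (\<lambda>x. x) \<and> prob_space.expectation F (\<lambda>x. x) = \<mu>"

text \<open>
  The next predicate is meant for \<open>F\<close> with a finite mean; integrability is stated explicitly because
  the Bochner integral of a non-integrable function is \<open>0\<close>.
\<close>

definition finite_variance :: "real measure \<Rightarrow> bool" where
  "finite_variance F \<longleftrightarrow> integrable F (\<lambda>x. (x - prob_space.expectation F (\<lambda>x. x))\<^sup>2)"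

definition is_solution :: "real measure \<Rightarrow> real \<Rightarrow> real measure \<Rightarrow> bool" where
  "is_solution FT \<mu> F \<longleftrightarrow>
     nonneg_distribution F \<and> has_mean F \<mu> \<and> finite_variance F \<and>
     (\<forall>s\<ge>0. laplace_stieltjes F s = 1 / (1 + sigma FT F s))"

end

theory Submission
  imports Defs "HOL-Real_Asymp.Real_Asymp"
begin

text \<open>
  Write \<open>\<phi>\<close> for the transform of \<open>F\<close>. Everything is governed by the behaviour of \<open>\<phi>\<close> at \<open>0\<close> to
  second order: for a nonnegative distribution, having mean \<open>\<mu>\<close> and second moment at most \<open>K\<close> implies
  \<open>1 - \<mu> * s \<le> \<phi> s \<le> 1 - \<mu> * s + K / 2 * s\<^sup>2\<close> for all \<open>s \<ge> 0\<close>, and these inequalities give back the mean and the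
  finiteness of the second moment.

  Necessity and variance. Expanding both sides of the equation to second order at \<open>0\<close> gives
  \<open>E X\<^sup>2 = E T * E X\<^sup>2 + 2 * \<mu>\<^sup>2\<close>. Since \<open>E X\<^sup>2\<close> is finite and \<open>\<mu> > 0\<close>, this forces \<open>E T < 1\<close>, and it
  determines the variance; see \<open>solution_moment_identity\<close>.

  Uniqueness. In the distance \<open>sup \<bar>\<phi> s - \<psi> s\<bar> / s\<^sup>2\<close>, which is finite between transforms with equal means
  and finite second moments, the right-hand side of the equation is a contraction with
  factor \<open>E T\<close>; see \<open>solution_unique\<close>. A distribution on the half-line is determined by its transform
  (\<open>laplace_eq_imp_eq\<close>).

  Existence. The difficulty is to see that iterates of the right-hand side are again transforms of
  distributions. When \<open>T\<close> is bounded away from \<open>0\<close>, the equation is equivalent to the fixed-point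
  equation of a recursion made of sums of independent variables, random scaling and thinning, so
  that its iterates are transforms by construction. This recursion preserves the two inequalities for
  suitable \<open>K\<close>, and it contracts the same distance when \<open>E T < 1\<close>. By tightness the iterates
  have a weak limit point, which is a fixed point (\<open>separated_scale.renewal_fixed_point_exists\<close>).
  A general \<open>T\<close> is approximated by \<open>max \<epsilon> T\<close>, and the same compactness (\<open>laplace_bounds_compact\<close>)
  produces a solution in the limit (\<open>solution_exists\<close>).
\<close>

section \<open>Laplace--Stieltjes transforms\<close>

lemma nonneg_distributionD:
  assumes "nonneg_distribution F"
  shows "real_distribution F" "AE x in F. 0 \<le> x"
  using assms by (auto simp: nonneg_distribution_def)

lemma laplace_integrable:
  assumes F: "nonneg_distribution F" and s: "0 \<le> s"
  shows "integrable F (\<lambda>x. exp (- s * x))"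
proof -
  interpret real_distribution F using nonneg_distributionD[OF F] by simp
  show ?thesis
    by (rule integrable_const_bound[where B = 1])
      (use nonneg_distributionD(2)[OF F] s in \<open>auto elim!: eventually_mono\<close>)
qed

lemma laplace_nonneg: "0 \<le> laplace_stieltjes F s"
  unfolding laplace_stieltjes_def by (intro integral_nonneg_AE) auto

lemma laplace_le_1:
  assumes F: "nonneg_distribution F" and s: "0 \<le> s"
  shows "laplace_stieltjes F s \<le> 1"
proof -
  interpret real_distribution F using nonneg_distributionD[OF F] by simp
  have "laplace_stieltjes F s \<le> (\<integral>x. 1 \<partial>F)"
    unfolding laplace_stieltjes_def
    by (intro integral_mono_AE laplace_integrable F s)
      (use nonneg_distributionD(2)[OF F] s in \<open>auto elim!: eventually_mono\<close>)
  then show ?thesis using prob_space by simp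
qed

lemma laplace_measurable [measurable]:
  assumes "nonneg_distribution F"
  shows "laplace_stieltjes F \<in> borel_measurable borel"
proof -
  interpret real_distribution F using nonneg_distributionD[OF assms] by simp
  show ?thesis unfolding laplace_stieltjes_def by measurable
qed

text \<open>
  The values \<open>laplace_stieltjes F n\<close> at natural numbers are the moments of \<open>exp (- X)\<close>. This variable
  lies in \<open>[0, 1]\<close>, so its characteristic function is the everywhere convergent power series
  built from these moments, and \<open>exp (- X)\<close> determines \<open>X\<close>.
\<close>

lemma laplace_eq_imp_eq:
  assumes F: "nonneg_distribution F" and G: "nonneg_distribution G"
    and eq: "\<And>s. 0 \<le> s \<Longrightarrow> laplace_stieltjes F s = laplace_stieltjes G s"
  shows "F = G"
proof -
  have char_series: "(\<lambda>n. (\<i> * complex_of_real t) ^ n / fact n * of_real (laplace_stieltjes H (real n)))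
          sums char (distr H borel (\<lambda>x. exp (- x))) t"
    if H: "nonneg_distribution H" for H t
  proof -
    interpret real_distribution H using nonneg_distributionD[OF H] by simp
    let ?f = "\<lambda>n x. (\<i> * complex_of_real t) ^ n / fact n * of_real (exp (- real n * x))"
    have series: "(\<lambda>n. ?f n x) sums iexp (t * exp (- x))" for x
    proof -
      have "(\<lambda>n. (\<i> * complex_of_real (t * exp (- x))) ^ n /\<^sub>R fact n) sums iexp (t * exp (- x))"
        by (rule exp_converges)
      also have "(\<lambda>n. (\<i> * complex_of_real (t * exp (- x))) ^ n /\<^sub>R fact n) = (\<lambda>n. ?f n x)"
        by (auto simp: fun_eq_iff power_mult_distrib scaleR_conv_of_real field_simps
            simp flip: of_real_power exp_of_nat_mult)
      finally show ?thesis .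
    qed
    have bound: "norm (?f n x) \<le> \<bar>t\<bar> ^ n / fact n" if "0 \<le> x" for n x
      using that by (simp add: norm_mult norm_power norm_divide mult_left_le divide_right_mono)
    have bound_AE: "AE x in H. norm (?f n x) \<le> \<bar>t\<bar> ^ n / fact n" for n
      using nonneg_distributionD(2)[OF H] bound by (auto elim!: eventually_mono)
    have summable_bound: "summable (\<lambda>n. \<bar>t\<bar> ^ n / fact n)"
      using summable_exp[of "\<bar>t\<bar>"] by (simp add: field_simps)
    have int: "integrable H (?f n)" for n
      by (rule integrable_const_bound[OF bound_AE]) measurable
    have "(\<lambda>n. integral\<^sup>L H (?f n)) sums (\<integral>x. (\<Sum>n. ?f n x) \<partial>H)"
    proof (rule sums_integral[OF int])
      show "AE x in H. summable (\<lambda>n. norm (?f n x))"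
        using nonneg_distributionD(2)[OF H]
        by eventually_elim (rule summable_comparison_test'[OF summable_bound], use bound in simp)
      have "(\<integral>x. norm (?f n x) \<partial>H) \<le> \<bar>t\<bar> ^ n / fact n" for n
        using integral_mono_AE[OF integrable_norm[OF int] integrable_const bound_AE]
        using prob_space by simp
      then show "summable (\<lambda>n. \<integral>x. norm (?f n x) \<partial>H)"
        by (intro summable_comparison_test'[OF summable_bound]) (auto simp: integral_nonneg_AE)
    qed
    also have "(\<lambda>n. integral\<^sup>L H (?f n)) =
        (\<lambda>n. (\<i> * complex_of_real t) ^ n / fact n * of_real (laplace_stieltjes H (real n)))"
      unfolding laplace_stieltjes_def
      by (intro ext, subst integral_mult_right_zero, subst integral_complex_of_real) (rule refl)
    also have "(\<integral>x. (\<Sum>n. ?f n x) \<partial>H) = (\<integral>x. iexp (t * exp (- x)) \<partial>H)"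
      using series by (simp add: sums_iff)
    also have "\<dots> = char (distr H borel (\<lambda>x. exp (- x))) t"
      by (simp add: char_def integral_distr)
    finally show ?thesis .
  qed
  interpret F: real_distribution F using nonneg_distributionD[OF F] by simp
  interpret G: real_distribution G using nonneg_distributionD[OF G] by simp
  have "char (distr F borel (\<lambda>x. exp (- x))) = char (distr G borel (\<lambda>x. exp (- x)))"
    using sums_unique2[OF char_series[OF F] ] char_series[OF G] by (auto simp: eq)
  then have "distr F borel (\<lambda>x. exp (- x)) = distr G borel (\<lambda>x. exp (- x))"
    by (intro Levy_uniqueness) auto
  then have "distr (distr F borel (\<lambda>x. exp (- x))) borel (\<lambda>y. - ln y) =
             distr (distr G borel (\<lambda>x. exp (- x))) borel (\<lambda>y. - ln y)"
    by simp
  then have "distr F borel (\<lambda>x. x) = distr G borel (\<lambda>x. x)"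
    by (simp add: distr_distr comp_def)
  then show ?thesis
    by (simp add: distr_id2)
qed

section \<open>Moments read off the transform\<close>

text \<open>
  Fatou's lemma for the Bochner integral. Below it supplies integrability that is not known in
  advance, both of powers of \<open>X\<close> and of the scale \<open>T\<close>.
\<close>

lemma Fatou_bound:
  fixes f :: "nat \<Rightarrow> 'a \<Rightarrow> real"
  assumes lim: "AE x in M. (\<lambda>n. f n x) \<longlonglongrightarrow> g x"
    and nonneg: "\<And>n. AE x in M. 0 \<le> f n x"
    and int: "\<And>n. integrable M (f n)" and bound: "\<And>n. (\<integral>x. f n x \<partial>M) \<le> C"
    and [measurable]: "g \<in> borel_measurable M"
  shows "integrable M g" "(\<integral>x. g x \<partial>M) \<le> C"
proof -
  note [measurable] = borel_measurable_integrable[OF int]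
  have all: "AE x in M. \<forall>n. 0 \<le> f n x" using nonneg by (simp add: AE_all_countable)
  have g_nonneg: "AE x in M. 0 \<le> g x"
    using all lim by eventually_elim (auto intro: LIMSEQ_le_const)
  have C: "0 \<le> C" using integral_nonneg_AE[OF nonneg[of 0]] bound[of 0] by simp
  have "(\<integral>\<^sup>+x. ennreal (g x) \<partial>M) = (\<integral>\<^sup>+x. liminf (\<lambda>n. ennreal (f n x)) \<partial>M)"
    using lim by (intro nn_integral_cong_AE, eventually_elim)
      (metis lim_imp_Liminf tendsto_ennrealI trivial_limit_sequentially)
  also have "\<dots> \<le> liminf (\<lambda>n. \<integral>\<^sup>+x. ennreal (f n x) \<partial>M)"
    by (rule nn_integral_liminf) measurable
  also have "\<dots> \<le> liminf (\<lambda>n. ennreal C)"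
    by (intro Liminf_mono always_eventually allI)
      (use nn_integral_eq_integral[OF int nonneg] bound in \<open>auto intro: ennreal_leI\<close>)
  also have "\<dots> = ennreal C" by (simp add: Liminf_const)
  finally have le: "(\<integral>\<^sup>+x. ennreal (g x) \<partial>M) \<le> ennreal C" .
  show "integrable M g"
    by (rule integrableI_nonneg[OF _ g_nonneg]) (use le in \<open>auto simp: le_less_trans\<close>)
  then show "(\<integral>x. g x \<partial>M) \<le> C"
    using le C by (simp add: nn_integral_eq_integral g_nonneg)
qed

lemma exp_minus_bounds:
  fixes y :: real
  assumes "0 \<le> y"
  shows "1 - y \<le> exp (- y)" "exp (- y) \<le> 1 - y + y\<^sup>2 / 2"
proof -
  show "1 - y \<le> exp (- y)" using exp_ge_add_one_self[of "- y"] by simp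
  have "(\<lambda>y::real. 1 - y + y\<^sup>2 / 2 - exp (- y)) 0 \<le> (\<lambda>y. 1 - y + y\<^sup>2 / 2 - exp (- y)) y"
  proof (rule DERIV_nonneg_imp_nondecreasing[OF assms])
    fix x :: real
    have "((\<lambda>y. 1 - y + y\<^sup>2 / 2 - exp (- y)) has_real_derivative - 1 + x + exp (- x)) (at x)"
      by (auto intro!: derivative_eq_intros)
    moreover have "0 \<le> - 1 + x + exp (- x)" using exp_ge_add_one_self[of "- x"] by simp
    ultimately show "\<exists>d. ((\<lambda>y. 1 - y + y\<^sup>2 / 2 - exp (- y)) has_real_derivative d) (at x) \<and> 0 \<le> d"
      by blast
  qed
  then show "exp (- y) \<le> 1 - y + y\<^sup>2 / 2" by simp
qed

lemma exp_quotient_limits: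
  fixes x :: real
  assumes "0 \<le> x"
  shows "((\<lambda>u. (1 - exp (- u * x)) / u) \<longlongrightarrow> x) (at_right 0)"
    and "((\<lambda>u. (exp (- u * x) - 1 + u * x) / u\<^sup>2) \<longlongrightarrow> x\<^sup>2 / 2) (at_right 0)"
proof -
  show "((\<lambda>u. (1 - exp (- u * x)) / u) \<longlongrightarrow> x) (at_right 0)"
    using assms by (cases "x = 0") (simp, real_asymp)
  show "((\<lambda>u. (exp (- u * x) - 1 + u * x) / u\<^sup>2) \<longlongrightarrow> x\<^sup>2 / 2) (at_right 0)"
  proof (cases "x = 0")
    case False
    with assms have "0 < x" by simp
    then have "((\<lambda>u. (exp (- u * x) - 1 + u * x) / u\<^sup>2) \<longlongrightarrow> x * x / 2) (at_right 0)"
      by real_asymp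
    then show ?thesis by (simp add: power2_eq_square)
  qed simp
qed

text \<open>
  For fixed \<open>\<mu>\<close> and \<open>K\<close> this encodes "mean \<open>\<mu>\<close> and second moment at most \<open>K\<close>" as two pointwise
  inequalities for the transform. Unlike the moment conditions themselves, the inequalities pass
  to weak limits, and they can be checked on the right-hand side of the functional equation
  without constructing a random variable.
\<close>

definition laplace_moment_bounds :: "real \<Rightarrow> real \<Rightarrow> real measure \<Rightarrow> bool" where
  "laplace_moment_bounds \<mu> K F \<longleftrightarrow> nonneg_distribution F \<and>
     (\<forall>s\<ge>0. 1 - \<mu> * s \<le> laplace_stieltjes F s \<and> laplace_stieltjes F s \<le> 1 - \<mu> * s + K / 2 * s\<^sup>2)"

lemma laplace_moment_boundsD:
  assumes "laplace_moment_bounds \<mu> K F"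
  shows "nonneg_distribution F"
    and "\<And>s. 0 \<le> s \<Longrightarrow> 1 - \<mu> * s \<le> laplace_stieltjes F s"
    and "\<And>s. 0 \<le> s \<Longrightarrow> laplace_stieltjes F s \<le> 1 - \<mu> * s + K / 2 * s\<^sup>2"
  using assms by (auto simp: laplace_moment_bounds_def)

text \<open>
  Integrate \<open>1 - y \<le> exp (- y) \<le> 1 - y + y\<^sup>2 / 2\<close> at \<open>y = s * x\<close>.
\<close>

lemma moments_imp_laplace_bounds:
  assumes F: "nonneg_distribution F" and int1: "integrable F (\<lambda>x. x)"
    and int2: "integrable F (\<lambda>x. x\<^sup>2)"
  shows "laplace_moment_bounds (\<integral>x. x \<partial>F) (\<integral>x. x\<^sup>2 \<partial>F) F"
  unfolding laplace_moment_bounds_def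
proof (intro conjI allI impI F)
  interpret real_distribution F using nonneg_distributionD[OF F] by simp
  fix s :: real assume s: "0 \<le> s"
  note pos = nonneg_distributionD(2)[OF F]
  have "AE x in F. 1 - s * x \<le> exp (- s * x)"
    using pos by eventually_elim (use s exp_minus_bounds(1) in simp)
  then have "(\<integral>x. 1 - s * x \<partial>F) \<le> laplace_stieltjes F s"
    unfolding laplace_stieltjes_def
    by (intro integral_mono_AE laplace_integrable[OF F s]) (use int1 in simp)
  then show "1 - (\<integral>x. x \<partial>F) * s \<le> laplace_stieltjes F s"
    using int1 prob_space by (simp add: mult.commute)
  have "AE x in F. exp (- s * x) \<le> 1 - s * x + s\<^sup>2 / 2 * x\<^sup>2"
    using pos
  proof eventually_elim
    fix x :: real assume "0 \<le> x"
    then show "exp (- s * x) \<le> 1 - s * x + s\<^sup>2 / 2 * x\<^sup>2"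
      using exp_minus_bounds(2)[of "s * x"] s by (simp add: power_mult_distrib)
  qed
  then have "laplace_stieltjes F s \<le> (\<integral>x. 1 - s * x + s\<^sup>2 / 2 * x\<^sup>2 \<partial>F)"
    unfolding laplace_stieltjes_def
    by (intro integral_mono_AE laplace_integrable[OF F s]) (use int1 int2 in simp)
  then show "laplace_stieltjes F s \<le> 1 - (\<integral>x. x \<partial>F) * s + (\<integral>x. x\<^sup>2 \<partial>F) / 2 * s\<^sup>2"
    using int1 int2 prob_space by (simp add: mult.commute)
qed

text \<open>
  The quotients \<open>(1 - exp (- u * x)) / u\<close> tend to \<open>x\<close> from below as \<open>u\<close> tends to \<open>0\<close>, and their integrals are
  squeezed by the two bounds between \<open>\<mu> - K / 2 * u\<close> and \<open>\<mu>\<close>. Fatou's lemma makes \<open>x\<close> integrable,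
  after which dominated convergence identifies the mean.
\<close>

lemma laplace_bounds_imp_mean:
  assumes "laplace_moment_bounds \<mu> K F"
  shows "integrable F (\<lambda>x. x)" "(\<integral>x. x \<partial>F) = \<mu>"
proof -
  note F = laplace_moment_boundsD(1)[OF assms]
  note lower = laplace_moment_boundsD(2)[OF assms]
  note upper = laplace_moment_boundsD(3)[OF assms]
  interpret real_distribution F using nonneg_distributionD[OF F] by simp
  note pos = nonneg_distributionD(2)[OF F]
  define u :: "nat \<Rightarrow> real" where "u n = 1 / (real n + 1)" for n
  have u_pos: "0 < u n" for n by (simp add: u_def)
  have u: "filterlim u (at_right 0) sequentially" unfolding u_def by real_asymp
  let ?f = "\<lambda>n x. (1 - exp (- u n * x)) / u n"
  have int: "integrable F (?f n)" for n
    using laplace_integrable[OF F, of "u n"] u_pos[of n] by (intro integrable_divide) auto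
  have val: "(\<integral>x. ?f n x \<partial>F) = (1 - laplace_stieltjes F (u n)) / u n" for n
    using laplace_integrable[OF F, of "u n"] u_pos[of n] prob_space
    by (simp add: laplace_stieltjes_def)
  have lim: "AE x in F. (\<lambda>n. ?f n x) \<longlonglongrightarrow> x"
    using pos by eventually_elim (rule filterlim_compose[OF exp_quotient_limits(1) u])
  have f_nonneg: "AE x in F. 0 \<le> ?f n x" for n
    using pos by eventually_elim (use u_pos[of n] in auto)
  have f_le: "AE x in F. norm (?f n x) \<le> x" for n
    using pos
  proof eventually_elim
    fix x :: real assume "0 \<le> x"
    then show "norm (?f n x) \<le> x"
      using u_pos[of n] exp_minus_bounds(1)[of "u n * x"] by (simp add: pos_divide_le_eq mult.commute)
  qed
  have le: "(1 - laplace_stieltjes F (u n)) / u n \<le> \<mu>" for n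
    using lower[of "u n"] u_pos[of n] by (simp add: pos_divide_le_eq)
  then have "(\<integral>x. ?f n x \<partial>F) \<le> \<mu>" for n unfolding val .
  then show int_x: "integrable F (\<lambda>x. x)"
    by (rule Fatou_bound(1)[OF lim f_nonneg int]) measurable
  have "(\<lambda>n. \<integral>x. ?f n x \<partial>F) \<longlonglongrightarrow> (\<integral>x. x \<partial>F)"
    by (rule integral_dominated_convergence[OF _ _ int_x lim f_le]) auto
  moreover have "(\<lambda>n. (1 - laplace_stieltjes F (u n)) / u n) \<longlonglongrightarrow> \<mu>"
  proof (rule tendsto_sandwich)
    have "\<mu> - K / 2 * u n \<le> (1 - laplace_stieltjes F (u n)) / u n" for n
    proof -
      have "(\<mu> - K / 2 * u n) * u n \<le> 1 - laplace_stieltjes F (u n)"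
        using upper[of "u n"] u_pos[of n] by (simp add: algebra_simps power2_eq_square)
      then show ?thesis using u_pos[of n] by (simp add: pos_le_divide_eq)
    qed
    then show "\<forall>\<^sub>F n in sequentially. \<mu> - K / 2 * u n \<le> (1 - laplace_stieltjes F (u n)) / u n"
      by simp
    show "\<forall>\<^sub>F n in sequentially. (1 - laplace_stieltjes F (u n)) / u n \<le> \<mu>"
      using le by simp
    show "(\<lambda>n. \<mu> - K / 2 * u n) \<longlonglongrightarrow> \<mu>" unfolding u_def by real_asymp
  qed simp
  ultimately show "(\<integral>x. x \<partial>F) = \<mu>"
    unfolding val by (rule LIMSEQ_unique)
qed

text \<open>
  The same argument one order higher, with \<open>(exp (- u * x) - 1 + u * x) / u\<^sup>2\<close> tending to \<open>x\<^sup>2 / 2\<close>.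
\<close>

lemma laplace_bounds_imp_second_moment:
  assumes "laplace_moment_bounds \<mu> K F"
  shows "integrable F (\<lambda>x. x\<^sup>2)"
proof -
  note F = laplace_moment_boundsD(1)[OF assms]
  note upper = laplace_moment_boundsD(3)[OF assms]
  note mean = laplace_bounds_imp_mean[OF assms]
  interpret real_distribution F using nonneg_distributionD[OF F] by simp
  note pos = nonneg_distributionD(2)[OF F]
  define u :: "nat \<Rightarrow> real" where "u n = 1 / (real n + 1)" for n
  have u_pos: "0 < u n" for n by (simp add: u_def)
  have u: "filterlim u (at_right 0) sequentially" unfolding u_def by real_asymp
  let ?f = "\<lambda>n x. (exp (- u n * x) - 1 + u n * x) / (u n)\<^sup>2"
  have int: "integrable F (?f n)" for n
    using laplace_integrable[OF F, of "u n"] u_pos[of n] mean(1) by (intro integrable_divide) auto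
  have val: "(\<integral>x. ?f n x \<partial>F) = (laplace_stieltjes F (u n) - 1 + u n * \<mu>) / (u n)\<^sup>2" for n
    using laplace_integrable[OF F, of "u n"] u_pos[of n] prob_space mean
    by (simp add: laplace_stieltjes_def)
  have lim: "AE x in F. (\<lambda>n. ?f n x) \<longlonglongrightarrow> x\<^sup>2 / 2"
    using pos by eventually_elim (rule filterlim_compose[OF exp_quotient_limits(2) u])
  have f_nonneg: "AE x in F. 0 \<le> ?f n x" for n
    using pos
  proof eventually_elim
    fix x :: real assume "0 \<le> x"
    then show "0 \<le> ?f n x" using u_pos[of n] exp_minus_bounds(1)[of "u n * x"] by auto
  qed
  have "(laplace_stieltjes F (u n) - 1 + u n * \<mu>) / (u n)\<^sup>2 \<le> K / 2" for n
    using upper[of "u n"] u_pos[of n] by (simp add: pos_divide_le_eq algebra_simps)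
  then have "(\<integral>x. ?f n x \<partial>F) \<le> K / 2" for n unfolding val .
  then have "integrable F (\<lambda>x. x\<^sup>2 / 2)"
    by (rule Fatou_bound(1)[OF lim f_nonneg int]) measurable
  from integrable_mult_right[OF this, of 2] show ?thesis by simp
qed

text \<open>
  The second-order expansion of the transform at \<open>0\<close>, with the exact coefficient. It replaces
  second derivatives at the boundary point \<open>0\<close>.
\<close>

lemma laplace_curvature_limit:
  assumes F: "nonneg_distribution F" and int1: "integrable F (\<lambda>x. x)"
    and int2: "integrable F (\<lambda>x. x\<^sup>2)"
    and u_pos: "\<And>n. 0 < u n" and u: "u \<longlonglongrightarrow> 0"
  shows "(\<lambda>n. (laplace_stieltjes F (u n) - 1 + u n * (\<integral>x. x \<partial>F)) / (u n)\<^sup>2)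
           \<longlonglongrightarrow> (\<integral>x. x\<^sup>2 \<partial>F) / 2"
proof -
  interpret real_distribution F using nonneg_distributionD[OF F] by simp
  note pos = nonneg_distributionD(2)[OF F]
  have u': "filterlim u (at_right 0) sequentially"
    using u u_pos by (auto simp: filterlim_at order_less_imp_not_eq2)
  let ?f = "\<lambda>n x. (exp (- u n * x) - 1 + u n * x) / (u n)\<^sup>2"
  have val: "(\<integral>x. ?f n x \<partial>F) = (laplace_stieltjes F (u n) - 1 + u n * (\<integral>x. x \<partial>F)) / (u n)\<^sup>2" for n
    using laplace_integrable[OF F, of "u n"] u_pos[of n] prob_space int1
    by (simp add: laplace_stieltjes_def)
  have "(\<lambda>n. \<integral>x. ?f n x \<partial>F) \<longlonglongrightarrow> (\<integral>x. x\<^sup>2 / 2 \<partial>F)"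
  proof (rule integral_dominated_convergence)
    show "integrable F (\<lambda>x. x\<^sup>2 / 2)" using int2 by simp
    show "AE x in F. (\<lambda>n. ?f n x) \<longlonglongrightarrow> x\<^sup>2 / 2"
      using pos by eventually_elim (rule filterlim_compose[OF exp_quotient_limits(2) u'])
    show "AE x in F. norm (?f n x) \<le> x\<^sup>2 / 2" for n
      using pos
    proof eventually_elim
      fix x :: real assume "0 \<le> x"
      then show "norm (?f n x) \<le> x\<^sup>2 / 2"
        using u_pos[of n] exp_minus_bounds[of "u n * x"]
        by (simp add: pos_divide_le_eq power_mult_distrib mult.commute)
    qed
  qed auto
  then show ?thesis unfolding val by simp
qed

section \<open>Closure properties of the class of transforms\<close>

lemma laplace_distr:
  assumes "prob_space N" and Z [measurable]: "Z \<in> borel_measurable N"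
    and nonneg: "\<And>\<omega>. \<omega> \<in> space N \<Longrightarrow> 0 \<le> Z \<omega>"
  shows "nonneg_distribution (distr N borel Z)"
    and "laplace_stieltjes (distr N borel Z) s = (\<integral>\<omega>. exp (- s * Z \<omega>) \<partial>N)"
proof -
  interpret prob_space N by fact
  show "nonneg_distribution (distr N borel Z)"
    using nonneg by (auto simp: nonneg_distribution_def AE_distr_iff)
  show "laplace_stieltjes (distr N borel Z) s = (\<integral>\<omega>. exp (- s * Z \<omega>) \<partial>N)"
    by (simp add: laplace_stieltjes_def integral_distr)
qed

lemma laplace_distr_pair:
  fixes Z :: "'a \<times> 'b \<Rightarrow> real"
  assumes P: "prob_space P" and Q: "prob_space Q"
    and [measurable]: "Z \<in> borel_measurable (P \<Otimes>\<^sub>M Q)" and nonneg: "\<And>\<omega>. 0 \<le> Z \<omega>"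
  shows "nonneg_distribution (distr (P \<Otimes>\<^sub>M Q) borel Z)"
    and "0 \<le> s \<Longrightarrow> laplace_stieltjes (distr (P \<Otimes>\<^sub>M Q) borel Z) s =
           (\<integral>x. (\<integral>y. exp (- s * Z (x, y)) \<partial>Q) \<partial>P)"
proof -
  interpret P: prob_space P by fact
  interpret Q: prob_space Q by fact
  interpret PQ: pair_prob_space P Q ..
  have pair: "prob_space (P \<Otimes>\<^sub>M Q)" by unfold_locales
  show "nonneg_distribution (distr (P \<Otimes>\<^sub>M Q) borel Z)"
    by (rule laplace_distr[OF pair]) (use nonneg in auto)
  assume s: "0 \<le> s"
  have "laplace_stieltjes (distr (P \<Otimes>\<^sub>M Q) borel Z) s = (\<integral>\<omega>. exp (- s * Z \<omega>) \<partial>(P \<Otimes>\<^sub>M Q))"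
    by (rule laplace_distr[OF pair]) (use nonneg in auto)
  also have "\<dots> = (\<integral>x. (\<integral>y. exp (- s * Z (x, y)) \<partial>Q) \<partial>P)"
    by (rule PQ.integral_fst'[symmetric], rule PQ.integrable_const_bound[where B = 1])
      (use s nonneg in auto)
  finally show "laplace_stieltjes (distr (P \<Otimes>\<^sub>M Q) borel Z) s =
           (\<integral>x. (\<integral>y. exp (- s * Z (x, y)) \<partial>Q) \<partial>P)" .
qed

text \<open>
  A nonnegative distribution is nonnegative only almost everywhere. Replacing \<open>x\<close> by \<open>max 0 x\<close> makes
  the variables built below nonnegative at every point.
\<close>

lemma laplace_positive_part:
  assumes F: "nonneg_distribution F"
  shows "(\<integral>x. exp (- s * max 0 x) \<partial>F) = laplace_stieltjes F s"
proof -
  interpret real_distribution F using nonneg_distributionD[OF F] by simp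
  have "AE x in F. exp (- s * max 0 x) = exp (- s * x)"
    using nonneg_distributionD(2)[OF F] by eventually_elim simp
  then show ?thesis
    unfolding laplace_stieltjes_def by (intro integral_cong_AE) auto
qed

text \<open>The sum of two independent variables.\<close>

lemma laplace_product_exists:
  assumes F: "nonneg_distribution F" and G: "nonneg_distribution G"
  shows "\<exists>H. nonneg_distribution H \<and>
    (\<forall>s\<ge>0. laplace_stieltjes H s = laplace_stieltjes F s * laplace_stieltjes G s)"
proof -
  interpret F: real_distribution F using nonneg_distributionD[OF F] by simp
  interpret G: real_distribution G using nonneg_distributionD[OF G] by simp
  let ?H = "distr (F \<Otimes>\<^sub>M G) borel (\<lambda>(x, y). max 0 x + max 0 y)"
  have split: "exp (- s * (max 0 x + max 0 y)) = exp (- s * max 0 x) * exp (- s * max 0 y)"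
    for s x y :: real
    by (simp add: distrib_left exp_diff exp_minus field_simps)
  have "laplace_stieltjes ?H s = laplace_stieltjes F s * laplace_stieltjes G s" if "0 \<le> s" for s
  proof -
    have "laplace_stieltjes ?H s = (\<integral>x. (\<integral>y. exp (- s * (max 0 x + max 0 y)) \<partial>G) \<partial>F)"
      using laplace_distr_pair(2)[OF F.prob_space_axioms G.prob_space_axioms _ _ that,
          of "\<lambda>(x, y). max 0 x + max 0 y"]
      by (auto simp: split_beta)
    then show ?thesis
      unfolding split integral_mult_right_zero integral_mult_left_zero
        laplace_positive_part[OF F] laplace_positive_part[OF G] .
  qed
  moreover have "nonneg_distribution ?H"
    by (rule laplace_distr_pair(1)[OF F.prob_space_axioms G.prob_space_axioms]) auto
  ultimately show ?thesis by blast
qed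

text \<open>The product of a variable with an independent random factor.\<close>

lemma laplace_scale_mixture_exists:
  assumes F: "nonneg_distribution F" and Q: "prob_space Q"
    and [measurable]: "\<tau> \<in> borel_measurable Q" and nonneg: "\<And>\<omega>. 0 \<le> \<tau> \<omega>"
  shows "\<exists>H. nonneg_distribution H \<and>
    (\<forall>s\<ge>0. laplace_stieltjes H s = (\<integral>\<omega>. laplace_stieltjes F (\<tau> \<omega> * s) \<partial>Q))"
proof -
  interpret F: real_distribution F using nonneg_distributionD[OF F] by simp
  interpret Q: prob_space Q by fact
  let ?H = "distr (Q \<Otimes>\<^sub>M F) borel (\<lambda>(\<omega>, x). max 0 x * \<tau> \<omega>)"
  have reassoc: "exp (- s * (max 0 x * \<tau> \<omega>)) = exp (- (\<tau> \<omega> * s) * max 0 x)" for s x \<omega>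
    by (simp add: mult_ac)
  have "laplace_stieltjes ?H s = (\<integral>\<omega>. laplace_stieltjes F (\<tau> \<omega> * s) \<partial>Q)" if "0 \<le> s" for s
  proof -
    have "laplace_stieltjes ?H s = (\<integral>\<omega>. (\<integral>x. exp (- s * (max 0 x * \<tau> \<omega>)) \<partial>F) \<partial>Q)"
      using laplace_distr_pair(2)[OF Q F.prob_space_axioms _ _ that,
          of "\<lambda>(\<omega>, x). max 0 x * \<tau> \<omega>"] nonneg
      by (auto simp: split_beta)
    then show ?thesis unfolding reassoc laplace_positive_part[OF F] .
  qed
  moreover have "nonneg_distribution ?H"
    by (rule laplace_distr_pair(1)[OF Q F.prob_space_axioms]) (use nonneg in auto)
  ultimately show ?thesis by blast
qed

text \<open>
  Multiplication by an independent Bernoulli variable with parameter \<open>q\<close>.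
\<close>

lemma laplace_thinning_exists:
  assumes F: "nonneg_distribution F" and q: "0 \<le> q" "q \<le> 1"
  shows "\<exists>H. nonneg_distribution H \<and>
    (\<forall>s\<ge>0. laplace_stieltjes H s = 1 - q + q * laplace_stieltjes F s)"
proof -
  interpret F: real_distribution F using nonneg_distributionD[OF F] by simp
  have "laplace_stieltjes F 0 = 1" by (simp add: laplace_stieltjes_def F.prob_space[simplified])
  then have "(\<integral>b. laplace_stieltjes F (of_bool b * s) \<partial>measure_pmf (bernoulli_pmf q))
      = 1 - q + q * laplace_stieltjes F s" for s
    using q by (simp add: integral_bernoulli_pmf)
  with laplace_scale_mixture_exists[OF F measure_pmf.prob_space_axioms, of "of_bool" "bernoulli_pmf q"]
  show ?thesis by simp
qed

text \<open>
  A common mean makes the sequence tight by Markov's inequality, so Helly's selection theorem gives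
  a weak limit. On the half-line the transforms are integrals of bounded continuous functions,
  hence they converge, and the bounds, being pointwise inequalities, are inherited.
  In particular no mass of the mean is lost in the limit.
\<close>

lemma laplace_bounds_compact:
  assumes "\<And>n. laplace_moment_bounds \<mu> K (F n)"
  obtains r G where "strict_mono (r :: nat \<Rightarrow> nat)" "laplace_moment_bounds \<mu> K G"
    "\<And>s. 0 \<le> s \<Longrightarrow> (\<lambda>n. laplace_stieltjes (F (r n)) s) \<longlonglongrightarrow> laplace_stieltjes G s"
proof -
  note F = laplace_moment_boundsD(1)[OF assms]
  note mean = laplace_bounds_imp_mean[OF assms]
  interpret F: real_distribution "F n" for n using nonneg_distributionD(1)[OF F] .
  have mu: "0 \<le> \<mu>"
    using integral_nonneg_AE[OF nonneg_distributionD(2)[OF F[of 0]]] mean(2)[of 0] by simp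
  have "tight F"
    unfolding tight_def
  proof (intro conjI allI impI)
    show "real_distribution (F n)" for n by (rule F.real_distribution_axioms)
    fix e :: real assume e: "0 < e"
    \<comment> \<open>Chosen with \<open>\<mu> / b < e\<close>; the summand \<open>1\<close> keeps \<open>b\<close> positive when \<open>\<mu> = 0\<close>.\<close>
    define b where "b = (\<mu> + 1) / e"
    have b: "0 < b" using mu e by (simp add: b_def)
    have "measure (F n) {- 1<..b} > 1 - e" for n
    proof -
      have "measure (F n) {x \<in> space (F n). x \<ge> b} \<le> \<mu> / b"
        using integral_Markov_inequality_measure[OF mean(1), of UNIV n b]
          nonneg_distributionD(2)[OF F[of n]] b mean(2)[of n] by simp
      also have "\<mu> / b < e" using b e mu by (simp add: b_def field_simps)
      finally have small: "measure (F n) {b..} < e" by (simp add: atLeast_def)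
      have "measure (F n) (UNIV - {- 1<..b}) \<le> measure (F n) ({b..} \<union> {..<0})"
        by (intro F.finite_measure_mono) auto
      also have "\<dots> \<le> measure (F n) {b..} + measure (F n) {..<0}"
        by (rule measure_Un_le) auto
      also have "measure (F n) {..<0} = 0"
        using nonneg_distributionD(2)[OF F[of n]]
        by (subst F.prob_eq_0) (auto elim!: eventually_mono)
      finally show ?thesis
        using small F.prob_compl[of "{- 1<..b}" n] by simp
    qed
    then show "\<exists>a b. a < b \<and> (\<forall>n. 1 - e < measure (F n) {a<..b})"
      using b by (intro exI[of _ "- 1"] exI[of _ b]) auto
  qed
  from tight_imp_convergent_subsubsequence[OF this strict_mono_id]
  obtain r G where r: "strict_mono (r :: nat \<Rightarrow> nat)" and G: "real_distribution G"
    and conv: "weak_conv_m (\<lambda>n. F (r n)) G" by (auto simp: comp_def)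
  interpret G: real_distribution G by fact
  have integral_conv: "(\<lambda>n. integral\<^sup>L (F (r n)) f) \<longlonglongrightarrow> integral\<^sup>L G f"
    if "\<And>x. isCont f x" "\<And>x. norm (f x) \<le> B" for f :: "real \<Rightarrow> real" and B
    by (rule weak_conv_imp_integral_bdd_continuous_conv[OF _ G conv that])
      (rule F.real_distribution_axioms)
  have "AE x in G. 0 \<le> x"
  proof -
    \<comment> \<open>A bounded continuous function that vanishes exactly on the nonnegative half-line.\<close>
    let ?f = "\<lambda>x::real. min 1 (max 0 (- x))"
    have "(\<integral>x. ?f x \<partial>F (r n)) = 0" for n
      using nonneg_distributionD(2)[OF F[of "r n"]]
      by (subst integral_cong_AE[where g = "\<lambda>_. 0"]) (auto elim!: eventually_mono)
    moreover have "isCont ?f x" for x by (intro continuous_min continuous_max continuous_intros)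
    ultimately have "(\<integral>x. ?f x \<partial>G) = 0"
      using integral_conv[of ?f 1] by (simp add: LIMSEQ_const_iff)
    moreover have "integrable G ?f" by (rule G.integrable_const_bound[where B = 1]) auto
    ultimately have "AE x in G. ?f x = 0"
      by (subst (asm) integral_nonneg_eq_0_iff_AE) auto
    then show ?thesis by eventually_elim (auto simp: min_def max_def split: if_splits)
  qed
  with G have G': "nonneg_distribution G" by (simp add: nonneg_distribution_def)
  have lim: "(\<lambda>n. laplace_stieltjes (F (r n)) s) \<longlonglongrightarrow> laplace_stieltjes G s" if s: "0 \<le> s" for s
  proof -
    have "isCont (\<lambda>x. exp (- s * max 0 x)) x" for x
      by (intro isCont_exp' continuous_max continuous_intros)
    then show ?thesis
      using integral_conv[of "\<lambda>x. exp (- s * max 0 x)" 1] s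
      unfolding laplace_positive_part[OF F] laplace_positive_part[OF G'] by simp
  qed
  have "1 - \<mu> * s \<le> laplace_stieltjes G s"
    "laplace_stieltjes G s \<le> 1 - \<mu> * s + K / 2 * s\<^sup>2" if s: "0 \<le> s" for s
    using laplace_moment_boundsD(2,3)[OF assms s]
    by (auto intro: LIMSEQ_le_const[OF lim[OF s]] LIMSEQ_le_const2[OF lim[OF s]])
  with G' have "laplace_moment_bounds \<mu> K G" by (simp add: laplace_moment_bounds_def)
  from that[OF r this lim] show thesis .
qed

section \<open>Existence for scales bounded away from zero\<close>

lemma one_minus_laplace_le:
  assumes "laplace_moment_bounds \<mu> K F" "0 \<le> s"
  shows "0 \<le> 1 - laplace_stieltjes F s" "1 - laplace_stieltjes F s \<le> \<mu> * s"
  using laplace_moment_boundsD(2)[OF assms]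
    laplace_le_1[OF laplace_moment_boundsD(1)[OF assms(1)] assms(2)] by auto

lemma laplace_bounds_mean_nonneg:
  assumes "laplace_moment_bounds \<mu> K F"
  shows "0 \<le> \<mu>"
  using one_minus_laplace_le[OF assms, of 1] by simp

text \<open>
  If \<open>\<tau> \<ge> \<epsilon> > 0\<close>, then \<open>1 / \<tau>\<close> is integrable and the functional equation can be multiplied out:
  with \<open>rate = E (1 / \<tau>)\<close>, the equation \<open>\<phi> s * (1 + E ((1 - \<phi> (\<tau> * s)) / \<tau>)) = 1\<close> becomes
  \<open>\<phi> s * (1 + rate) = 1 + \<phi> s * E (\<phi> (\<tau> * s) / \<tau>)\<close>.
\<close>

locale separated_scale = prob_space N for N :: "'a measure" +
  fixes \<tau> :: "'a \<Rightarrow> real" and \<epsilon> :: real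
  assumes tau_measurable [measurable]: "\<tau> \<in> borel_measurable N"
    and eps_pos: "0 < \<epsilon>" and tau_ge: "\<And>\<omega>. \<epsilon> \<le> \<tau> \<omega>"
    and tau_integrable: "integrable N \<tau>"
begin

lemma tau_pos: "0 < \<tau> \<omega>" using eps_pos tau_ge[of \<omega>] by simp

definition rate :: real where "rate = (\<integral>\<omega>. 1 / \<tau> \<omega> \<partial>N)"

lemma inverse_integrable: "integrable N (\<lambda>\<omega>. 1 / \<tau> \<omega>)"
proof (rule integrable_const_bound[where B = "1 / \<epsilon>"])
  show "AE \<omega> in N. norm (1 / \<tau> \<omega>) \<le> 1 / \<epsilon>"
    using tau_pos tau_ge eps_pos by (intro always_eventually allI) (simp add: frac_le less_imp_le)
qed measurable

lemma rate_pos: "0 < rate"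
proof -
  have "rate \<noteq> 0"
    unfolding rate_def
    by (subst integral_nonneg_eq_0_iff_AE[OF inverse_integrable])
      (use tau_pos in \<open>auto simp: less_imp_le less_imp_neq[symmetric] AE_False\<close>)
  moreover have "0 \<le> rate"
    unfolding rate_def using tau_pos by (intro integral_nonneg_AE) (auto simp: less_imp_le)
  ultimately show ?thesis by simp
qed

lemma weighted_integrable:
  assumes F: "nonneg_distribution F" and s: "0 \<le> s"
  shows "integrable N (\<lambda>\<omega>. laplace_stieltjes F (\<tau> \<omega> * s) / \<tau> \<omega>)"
proof (rule Bochner_Integration.integrable_bound[OF inverse_integrable])
  note [measurable] = laplace_measurable[OF F]
  show "(\<lambda>\<omega>. laplace_stieltjes F (\<tau> \<omega> * s) / \<tau> \<omega>) \<in> borel_measurable N" by measurable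
  show "AE \<omega> in N. norm (laplace_stieltjes F (\<tau> \<omega> * s) / \<tau> \<omega>) \<le> norm (1 / \<tau> \<omega>)"
  proof (intro always_eventually allI)
    fix \<omega>
    have "0 \<le> \<tau> \<omega> * s" using tau_pos[of \<omega>] s by simp
    then show "norm (laplace_stieltjes F (\<tau> \<omega> * s) / \<tau> \<omega>) \<le> norm (1 / \<tau> \<omega>)"
      using laplace_le_1[OF F] tau_pos[of \<omega>] laplace_nonneg
      by (simp add: divide_right_mono)
  qed
qed

text \<open>
  One step of the renewal recursion whose stationary laws solve the functional equation. If \<open>\<phi>\<close> is the
  transform of \<open>X\<close>, this is the transform of \<open>B * (X + \<tau>' * Y)\<close> with independent factors: \<open>Y\<close> is a copy
  of \<open>X\<close>, \<open>\<tau>'\<close> has density \<open>1 / (rate * \<tau>)\<close> with respect to the law of \<open>\<tau>\<close>, and \<open>B\<close> is Bernoulli with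
  parameter \<open>rate / (1 + rate)\<close>.
\<close>

definition renewal :: "(real \<Rightarrow> real) \<Rightarrow> real \<Rightarrow> real" where
  "renewal \<phi> s = (1 + \<phi> s * (\<integral>\<omega>. \<phi> (\<tau> \<omega> * s) / \<tau> \<omega> \<partial>N)) / (1 + rate)"

lemma renewal_distribution_exists:
  assumes F: "nonneg_distribution F"
  shows "\<exists>G. nonneg_distribution G \<and>
    (\<forall>s\<ge>0. laplace_stieltjes G s = renewal (laplace_stieltjes F) s)"
proof -
  note [measurable] = laplace_measurable[OF F]
  define W where "W = density N (\<lambda>\<omega>. ennreal (1 / (rate * \<tau> \<omega>)))"
  have w_nonneg: "0 \<le> 1 / (rate * \<tau> \<omega>)" for \<omega>
    using rate_pos tau_pos[of \<omega>] by simp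
  have w_int: "integrable N (\<lambda>\<omega>. 1 / (rate * \<tau> \<omega>))" "(\<integral>\<omega>. 1 / (rate * \<tau> \<omega>) \<partial>N) = 1"
    using integrable_mult_right[OF inverse_integrable, of "1 / rate"] rate_pos
      integral_mult_right_zero[of N "1 / rate" "\<lambda>\<omega>. 1 / \<tau> \<omega>"]
    by (simp_all add: rate_def[symmetric])
  have "prob_space W"
  proof
    have "emeasure W (space W) = (\<integral>\<^sup>+\<omega>. ennreal (1 / (rate * \<tau> \<omega>)) \<partial>N)"
      by (simp add: W_def emeasure_density cong: nn_integral_cong_simp)
    also have "\<dots> = 1"
      using w_int w_nonneg by (subst nn_integral_eq_integral) auto
    finally show "emeasure W (space W) = 1" .
  qed
  moreover have "\<tau> \<in> borel_measurable W" by (simp add: W_def)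
  ultimately obtain H where H: "nonneg_distribution H"
    and H_eq: "\<And>s. 0 \<le> s \<Longrightarrow> laplace_stieltjes H s = (\<integral>\<omega>. laplace_stieltjes F (\<tau> \<omega> * s) \<partial>W)"
    using laplace_scale_mixture_exists[OF F, of W \<tau>] tau_pos by (auto simp: less_imp_le)
  have H_val: "laplace_stieltjes H s = (\<integral>\<omega>. laplace_stieltjes F (\<tau> \<omega> * s) / \<tau> \<omega> \<partial>N) / rate"
    if "0 \<le> s" for s
  proof -
    have "(\<integral>\<omega>. laplace_stieltjes F (\<tau> \<omega> * s) \<partial>W)
        = (\<integral>\<omega>. 1 / (rate * \<tau> \<omega>) * laplace_stieltjes F (\<tau> \<omega> * s) \<partial>N)"
      unfolding W_def by (rule integral_real_density) (use w_nonneg in auto)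
    also have "\<dots> = (\<integral>\<omega>. 1 / rate * (laplace_stieltjes F (\<tau> \<omega> * s) / \<tau> \<omega>) \<partial>N)"
      by (simp add: mult_ac)
    finally show ?thesis using H_eq[OF that] by (simp only: integral_mult_right_zero) simp
  qed
  obtain P where P: "nonneg_distribution P"
    and P_eq: "\<And>s. 0 \<le> s \<Longrightarrow> laplace_stieltjes P s = laplace_stieltjes F s * laplace_stieltjes H s"
    using laplace_product_exists[OF F H] by blast
  have "0 \<le> rate / (1 + rate)" "rate / (1 + rate) \<le> 1" using rate_pos by auto
  from laplace_thinning_exists[OF P this]
  obtain G where G: "nonneg_distribution G"
    and G_eq: "\<And>s. 0 \<le> s \<Longrightarrow> laplace_stieltjes G s =
        1 - rate / (1 + rate) + rate / (1 + rate) * laplace_stieltjes P s" by blast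
  have "laplace_stieltjes G s = renewal (laplace_stieltjes F) s" if "0 \<le> s" for s
  proof -
    have "1 - rate / (1 + rate) = 1 / (1 + rate)" using rate_pos by (simp add: field_simps)
    then show ?thesis
      unfolding G_eq[OF that] P_eq[OF that] H_val[OF that] renewal_def
      using rate_pos by (simp add: add_divide_distrib)
  qed
  with G show ?thesis by blast
qed

text \<open>
  All bounds on the integrand \<open>\<phi> s * \<phi> (\<tau> * s) / \<tau>\<close> below have the form \<open>a / \<tau> + b + c * \<tau>\<close>.
\<close>

lemma integral_affine:
  "integrable N (\<lambda>\<omega>. a / \<tau> \<omega> + b + c * \<tau> \<omega>)"
  "(\<integral>\<omega>. a / \<tau> \<omega> + b + c * \<tau> \<omega> \<partial>N) = a * rate + b + c * expectation \<tau>"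
proof -
  have "integrable N (\<lambda>\<omega>. a * (1 / \<tau> \<omega>))" by (intro integrable_mult_right inverse_integrable)
  moreover have "(\<integral>\<omega>. a * (1 / \<tau> \<omega>) \<partial>N) = a * rate"
    unfolding rate_def by (rule integral_mult_right_zero)
  ultimately show "integrable N (\<lambda>\<omega>. a / \<tau> \<omega> + b + c * \<tau> \<omega>)"
    "(\<integral>\<omega>. a / \<tau> \<omega> + b + c * \<tau> \<omega> \<partial>N) = a * rate + b + c * expectation \<tau>"
    using tau_integrable by (simp_all add: prob_space)
qed

lemma renewal_alt:
  assumes F: "nonneg_distribution F" and s: "0 \<le> s"
  shows "integrable N (\<lambda>\<omega>. laplace_stieltjes F s * laplace_stieltjes F (\<tau> \<omega> * s) / \<tau> \<omega>)"
    and "renewal (laplace_stieltjes F) s =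
      (1 + (\<integral>\<omega>. laplace_stieltjes F s * laplace_stieltjes F (\<tau> \<omega> * s) / \<tau> \<omega> \<partial>N)) / (1 + rate)"
  using integrable_mult_right[OF weighted_integrable[OF assms], of "laplace_stieltjes F s"]
    integral_mult_right_zero[of N "laplace_stieltjes F s" "\<lambda>\<omega>. laplace_stieltjes F (\<tau> \<omega> * s) / \<tau> \<omega>"]
  by (simp_all add: renewal_def)

text \<open>
  Both bounds come from writing \<open>\<phi> s * \<phi> (\<tau> * s) = 1 - a - b + a * b\<close> with \<open>a = 1 - \<phi> s\<close> and
  \<open>b = 1 - \<phi> (\<tau> * s)\<close>: the lower one drops \<open>a * b \<ge> 0\<close>, and the upper one uses
  \<open>a * b \<le> \<mu>\<^sup>2 * \<tau> * s\<^sup>2\<close>. This turns a second moment \<open>K\<close> into at most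
  \<open>(K * (rate + E \<tau>) + 2 * \<mu>\<^sup>2) / (1 + rate)\<close>, which does not exceed \<open>K\<close> exactly under the stated
  condition on \<open>K\<close>.
\<close>

lemma renewal_preserves_bounds:
  assumes F: "laplace_moment_bounds \<mu> K F"
    and K: "2 * \<mu>\<^sup>2 \<le> K * (1 - expectation \<tau>)"
    and G: "nonneg_distribution G"
    and G_eq: "\<And>s. 0 \<le> s \<Longrightarrow> laplace_stieltjes G s = renewal (laplace_stieltjes F) s"
  shows "laplace_moment_bounds \<mu> K G"
  unfolding laplace_moment_bounds_def
proof (intro conjI allI impI G)
  note F' = laplace_moment_boundsD(1)[OF F]
  fix s :: real assume s: "0 \<le> s"
  let ?p = "\<lambda>\<omega>. laplace_stieltjes F s * laplace_stieltjes F (\<tau> \<omega> * s)"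
  have mu: "0 \<le> \<mu>" by (rule laplace_bounds_mean_nonneg[OF F])
  have lower: "(1 - \<mu> * s) / \<tau> \<omega> + (- \<mu> * s) + 0 * \<tau> \<omega> \<le> ?p \<omega> / \<tau> \<omega>" for \<omega>
  proof -
    have ts: "0 \<le> \<tau> \<omega> * s" using tau_pos[of \<omega>] s by simp
    have "0 \<le> (1 - laplace_stieltjes F s) * (1 - laplace_stieltjes F (\<tau> \<omega> * s))"
      using one_minus_laplace_le(1)[OF F s] one_minus_laplace_le(1)[OF F ts] by simp
    then have "1 - \<mu> * s - \<mu> * (\<tau> \<omega> * s) \<le> ?p \<omega>"
      using one_minus_laplace_le(2)[OF F s] one_minus_laplace_le(2)[OF F ts]
      by (simp add: algebra_simps)
    from divide_right_mono[OF this, of "\<tau> \<omega>"] show ?thesis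
      using tau_pos[of \<omega>] by (simp add: diff_divide_distrib)
  qed
  have "(1 - \<mu> * s) * rate + (- \<mu> * s) + 0 * expectation \<tau> \<le> (\<integral>\<omega>. ?p \<omega> / \<tau> \<omega> \<partial>N)"
    unfolding integral_affine(2)[symmetric]
    by (intro integral_mono integral_affine renewal_alt F' s lower)
  then have "(1 + (1 - \<mu> * s) * rate - \<mu> * s) / (1 + rate) \<le> laplace_stieltjes G s"
    unfolding G_eq[OF s] renewal_alt(2)[OF F' s] using rate_pos
    by (intro divide_right_mono) auto
  moreover have "1 + (1 - \<mu> * s) * rate - \<mu> * s = (1 - \<mu> * s) * (1 + rate)"
    by (simp add: algebra_simps)
  ultimately show "1 - \<mu> * s \<le> laplace_stieltjes G s" using rate_pos by simp
  have upper: "?p \<omega> / \<tau> \<omega> \<le> (1 - \<mu> * s + K / 2 * s\<^sup>2) / \<tau> \<omega> + (- \<mu> * s + \<mu>\<^sup>2 * s\<^sup>2) + K / 2 * s\<^sup>2 * \<tau> \<omega>" for \<omega>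
  proof -
    have ts: "0 \<le> \<tau> \<omega> * s" using tau_pos[of \<omega>] s by simp
    have "(1 - laplace_stieltjes F s) * (1 - laplace_stieltjes F (\<tau> \<omega> * s)) \<le> (\<mu> * s) * (\<mu> * (\<tau> \<omega> * s))"
      using one_minus_laplace_le[OF F s] one_minus_laplace_le[OF F ts] mu s
      by (intro mult_mono) auto
    then have "?p \<omega> \<le> (1 - \<mu> * s + K / 2 * s\<^sup>2) + (- \<mu> * s + \<mu>\<^sup>2 * s\<^sup>2) * \<tau> \<omega> + K / 2 * s\<^sup>2 * \<tau> \<omega> * \<tau> \<omega>"
      using laplace_moment_boundsD(3)[OF F s] laplace_moment_boundsD(3)[OF F ts]
      by (simp add: algebra_simps power2_eq_square)
    from divide_right_mono[OF this, of "\<tau> \<omega>"] show ?thesis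
      using tau_pos[of \<omega>] by (simp add: add_divide_distrib less_imp_neq[symmetric])
  qed
  have "(\<integral>\<omega>. ?p \<omega> / \<tau> \<omega> \<partial>N) \<le>
      (1 - \<mu> * s + K / 2 * s\<^sup>2) * rate + (- \<mu> * s + \<mu>\<^sup>2 * s\<^sup>2) + K / 2 * s\<^sup>2 * expectation \<tau>"
    unfolding integral_affine(2)[symmetric]
    by (intro integral_mono integral_affine renewal_alt F' s upper)
  also have "\<dots> \<le> (1 - \<mu> * s + K / 2 * s\<^sup>2) * (1 + rate) - 1"
    using mult_right_mono[OF K, of "s\<^sup>2 / 2"] by (simp add: field_simps)
  finally show "laplace_stieltjes G s \<le> 1 - \<mu> * s + K / 2 * s\<^sup>2"
    unfolding G_eq[OF s] renewal_alt(2)[OF F' s] using rate_pos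
    by (simp add: pos_divide_le_eq)
qed

text \<open>
  Distances are measured relative to \<open>s\<^sup>2\<close>, since two transforms with the same mean agree to
  first order at \<open>0\<close>. The scaling \<open>s \<mapsto> \<tau> * s\<close> costs a factor \<open>\<tau>\<^sup>2\<close> in this metric, and the weight
  \<open>1 / \<tau>\<close> leaves \<open>\<tau>\<close>; thus the factor is below \<open>1\<close> exactly when \<open>E \<tau> < 1\<close>.
\<close>

lemma renewal_contraction:
  assumes F: "nonneg_distribution F" and G: "nonneg_distribution G"
    and D: "\<And>s. 0 \<le> s \<Longrightarrow> \<bar>laplace_stieltjes F s - laplace_stieltjes G s\<bar> \<le> D * s\<^sup>2"
    and s: "0 \<le> s"
  shows "\<bar>renewal (laplace_stieltjes F) s - renewal (laplace_stieltjes G) s\<bar>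
           \<le> D * ((rate + expectation \<tau>) / (1 + rate)) * s\<^sup>2"
proof -
  let ?p = "\<lambda>F \<omega>. laplace_stieltjes F s * laplace_stieltjes F (\<tau> \<omega> * s)"
  have bound: "\<bar>?p F \<omega> / \<tau> \<omega> - ?p G \<omega> / \<tau> \<omega>\<bar> \<le> (D * s\<^sup>2) / \<tau> \<omega> + 0 + D * s\<^sup>2 * \<tau> \<omega>" for \<omega>
  proof -
    have ts: "0 \<le> \<tau> \<omega> * s" using tau_pos[of \<omega>] s by simp
    have "?p F \<omega> - ?p G \<omega> =
        (laplace_stieltjes F s - laplace_stieltjes G s) * laplace_stieltjes F (\<tau> \<omega> * s)
        + laplace_stieltjes G s * (laplace_stieltjes F (\<tau> \<omega> * s) - laplace_stieltjes G (\<tau> \<omega> * s))"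
      by (simp add: algebra_simps)
    also have "\<bar>\<dots>\<bar> \<le> \<bar>laplace_stieltjes F s - laplace_stieltjes G s\<bar> * 1
        + 1 * \<bar>laplace_stieltjes F (\<tau> \<omega> * s) - laplace_stieltjes G (\<tau> \<omega> * s)\<bar>"
      using laplace_le_1[OF F ts] laplace_le_1[OF G s] laplace_nonneg
      by (intro order_trans[OF abs_triangle_ineq] add_mono)
        (auto simp: abs_mult intro!: mult_left_le mult_left_le_one_le)
    also have "\<dots> \<le> D * s\<^sup>2 + D * (\<tau> \<omega> * s)\<^sup>2" using D[OF s] D[OF ts] by simp
    finally have "\<bar>?p F \<omega> - ?p G \<omega>\<bar> \<le> D * s\<^sup>2 + D * s\<^sup>2 * \<tau> \<omega> * \<tau> \<omega>"
      by (simp add: power2_eq_square mult_ac)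
    from divide_right_mono[OF this, of "\<tau> \<omega>"] show ?thesis
      using tau_pos[of \<omega>]
      by (simp add: add_divide_distrib less_imp_neq[symmetric] flip: diff_divide_distrib)
  qed
  have "\<bar>(\<integral>\<omega>. ?p F \<omega> / \<tau> \<omega> \<partial>N) - (\<integral>\<omega>. ?p G \<omega> / \<tau> \<omega> \<partial>N)\<bar>
      = \<bar>\<integral>\<omega>. ?p F \<omega> / \<tau> \<omega> - ?p G \<omega> / \<tau> \<omega> \<partial>N\<bar>"
    using renewal_alt(1)[OF F s] renewal_alt(1)[OF G s] by simp
  also have "\<dots> \<le> (\<integral>\<omega>. \<bar>?p F \<omega> / \<tau> \<omega> - ?p G \<omega> / \<tau> \<omega>\<bar> \<partial>N)" by (rule integral_abs_bound)
  also have "\<dots> \<le> (D * s\<^sup>2) * rate + 0 + D * s\<^sup>2 * expectation \<tau>"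
    unfolding integral_affine(2)[symmetric]
    by (intro integral_mono integral_affine bound integrable_abs
        Bochner_Integration.integrable_diff renewal_alt(1) F G s)
  finally have "\<bar>(\<integral>\<omega>. ?p F \<omega> / \<tau> \<omega> \<partial>N) - (\<integral>\<omega>. ?p G \<omega> / \<tau> \<omega> \<partial>N)\<bar> / (1 + rate)
      \<le> (D * s\<^sup>2 * rate + 0 + D * s\<^sup>2 * expectation \<tau>) / (1 + rate)"
    using rate_pos by (intro divide_right_mono) auto
  then show ?thesis
    unfolding renewal_alt(2)[OF F s] renewal_alt(2)[OF G s] using rate_pos
    by (simp add: abs_divide algebra_simps flip: diff_divide_distrib)
qed

end

text \<open>
  Finiteness of the distance relative to \<open>s\<^sup>2\<close>, from which the contractions start.
\<close>

lemma laplace_difference_le: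
  assumes F: "laplace_moment_bounds \<mu> K F" and G: "laplace_moment_bounds \<mu> L G" and s: "0 \<le> s"
  shows "\<bar>laplace_stieltjes F s - laplace_stieltjes G s\<bar> \<le> max K L / 2 * s\<^sup>2"
proof -
  have le: "K / 2 * s\<^sup>2 \<le> max K L / 2 * s\<^sup>2" "L / 2 * s\<^sup>2 \<le> max K L / 2 * s\<^sup>2"
    by (rule mult_right_mono, simp, simp)+
  have squeeze: "\<bar>a - b\<bar> \<le> c" if "l \<le> a" "a \<le> l + c" "l \<le> b" "b \<le> l + c" for a b c l :: real
    using that by (auto simp: abs_le_iff)
  show ?thesis
    by (rule squeeze[OF laplace_moment_boundsD(2)[OF F s]
          order_trans[OF laplace_moment_boundsD(3)[OF F s] add_left_mono[OF le(1)]]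
          laplace_moment_boundsD(2)[OF G s]
          order_trans[OF laplace_moment_boundsD(3)[OF G s] add_left_mono[OF le(2)]]])
qed

lemma laplace_bounds_return:
  assumes "0 \<le> \<mu>" "\<mu>\<^sup>2 \<le> K"
  shows "laplace_moment_bounds \<mu> K (return borel \<mu>)"
  unfolding laplace_moment_bounds_def
proof (intro conjI allI impI)
  show "nonneg_distribution (return borel \<mu>)"
    using assms by (auto simp: nonneg_distribution_def real_distribution_def
        real_distribution_axioms_def prob_space_return AE_return)
  fix s :: real assume s: "0 \<le> s"
  have val: "laplace_stieltjes (return borel \<mu>) s = exp (- (\<mu> * s))"
    by (simp add: laplace_stieltjes_def integral_return mult.commute)
  show "1 - \<mu> * s \<le> laplace_stieltjes (return borel \<mu>) s"
    unfolding val by (rule exp_minus_bounds) (use assms s in simp)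
  have "exp (- (\<mu> * s)) \<le> 1 - \<mu> * s + (\<mu> * s)\<^sup>2 / 2"
    by (rule exp_minus_bounds) (use assms s in simp)
  also have "(\<mu> * s)\<^sup>2 / 2 \<le> K / 2 * s\<^sup>2"
    using mult_right_mono[OF assms(2), of "s\<^sup>2"] by (simp add: power_mult_distrib)
  finally show "laplace_stieltjes (return borel \<mu>) s \<le> 1 - \<mu> * s + K / 2 * s\<^sup>2"
    unfolding val by simp
qed

context separated_scale
begin

lemma renewal_continuous:
  assumes F: "\<And>n. nonneg_distribution (F n)" and G: "nonneg_distribution G"
    and lim: "\<And>s. 0 \<le> s \<Longrightarrow> (\<lambda>n. laplace_stieltjes (F n) s) \<longlonglongrightarrow> laplace_stieltjes G s"
    and s: "0 \<le> s"
  shows "(\<lambda>n. renewal (laplace_stieltjes (F n)) s) \<longlonglongrightarrow> renewal (laplace_stieltjes G) s"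
proof -
  note [measurable] = laplace_measurable[OF F] laplace_measurable[OF G]
  have "(\<lambda>n. \<integral>\<omega>. laplace_stieltjes (F n) (\<tau> \<omega> * s) / \<tau> \<omega> \<partial>N)
      \<longlonglongrightarrow> (\<integral>\<omega>. laplace_stieltjes G (\<tau> \<omega> * s) / \<tau> \<omega> \<partial>N)"
  proof (rule integral_dominated_convergence[OF _ _ inverse_integrable])
    show "AE \<omega> in N. (\<lambda>n. laplace_stieltjes (F n) (\<tau> \<omega> * s) / \<tau> \<omega>)
        \<longlonglongrightarrow> laplace_stieltjes G (\<tau> \<omega> * s) / \<tau> \<omega>"
    proof (intro always_eventually allI)
      fix \<omega>
      have "0 \<le> \<tau> \<omega> * s" using tau_pos[of \<omega>] s by simp
      from lim[OF this] show "(\<lambda>n. laplace_stieltjes (F n) (\<tau> \<omega> * s) / \<tau> \<omega>)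
        \<longlonglongrightarrow> laplace_stieltjes G (\<tau> \<omega> * s) / \<tau> \<omega>"
        using tau_pos[of \<omega>] by (intro tendsto_divide tendsto_const) auto
    qed
    show "AE \<omega> in N. norm (laplace_stieltjes (F n) (\<tau> \<omega> * s) / \<tau> \<omega>) \<le> 1 / \<tau> \<omega>" for n
    proof (intro always_eventually allI)
      fix \<omega>
      have "0 \<le> \<tau> \<omega> * s" using tau_pos[of \<omega>] s by simp
      then show "norm (laplace_stieltjes (F n) (\<tau> \<omega> * s) / \<tau> \<omega>) \<le> 1 / \<tau> \<omega>"
        using laplace_le_1[OF F] tau_pos[of \<omega>] laplace_nonneg
        by (simp add: divide_right_mono)
    qed
  qed measurable
  then show ?thesis
    unfolding renewal_def using rate_pos by (intro tendsto_intros lim s) auto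
qed

text \<open>
  Iterate the recursion from the point mass at \<open>\<mu>\<close>. Consecutive transforms approach each
  other geometrically, so every weak limit point of the iterates is a fixed point.
\<close>

lemma renewal_fixed_point_exists:
  assumes mu: "0 \<le> \<mu>" and m: "expectation \<tau> < 1"
    and K: "2 * \<mu>\<^sup>2 \<le> K * (1 - expectation \<tau>)"
  shows "\<exists>F. laplace_moment_bounds \<mu> K F \<and>
    (\<forall>s\<ge>0. renewal (laplace_stieltjes F) s = laplace_stieltjes F s)"
proof -
  have m_nonneg: "0 \<le> expectation \<tau>"
    using tau_pos by (intro integral_nonneg_AE) (auto simp: less_imp_le)
  have "0 \<le> K * (1 - expectation \<tau>)" using K zero_le_power2[of \<mu>] by linarith
  then have K_nonneg: "0 \<le> K" using m by (simp add: zero_le_mult_iff)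
  have "K * (1 - expectation \<tau>) \<le> K * 1" using m_nonneg K_nonneg by (intro mult_left_mono) auto
  then have K_ge: "\<mu>\<^sup>2 \<le> K" using K zero_le_power2[of \<mu>] by linarith
  define \<rho> where "\<rho> = (rate + expectation \<tau>) / (1 + rate)"
  have rho: "0 \<le> \<rho>" "\<rho> < 1" using rate_pos m m_nonneg by (auto simp: \<rho>_def)
  obtain step where step: "\<And>F. nonneg_distribution F \<Longrightarrow> nonneg_distribution (step F) \<and>
      (\<forall>s\<ge>0. laplace_stieltjes (step F) s = renewal (laplace_stieltjes F) s)"
    using renewal_distribution_exists by metis
  define F where "F n = (step ^^ n) (return borel \<mu>)" for n
  have F_Suc: "F (Suc n) = step (F n)" for n by (simp add: F_def)
  have bounds: "laplace_moment_bounds \<mu> K (F n)" for n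
  proof (induction n)
    case 0
    then show ?case using laplace_bounds_return[OF mu K_ge] by (simp add: F_def)
  next
    case (Suc n)
    note nonneg = laplace_moment_boundsD(1)[OF Suc]
    show ?case
      unfolding F_Suc by (rule renewal_preserves_bounds[OF Suc K]) (use step[OF nonneg] in auto)
  qed
  note F = laplace_moment_boundsD(1)[OF bounds]
  have F_step: "laplace_stieltjes (F (Suc n)) s = renewal (laplace_stieltjes (F n)) s"
    if "0 \<le> s" for n s using step[OF F] that by (simp add: F_Suc)
  have diff: "\<bar>laplace_stieltjes (F (Suc n)) s - laplace_stieltjes (F n) s\<bar> \<le> K / 2 * \<rho> ^ n * s\<^sup>2"
    if "0 \<le> s" for n s
    using that
  proof (induction n arbitrary: s)
    case 0
    show ?case
      using laplace_difference_le[OF bounds[of "Suc 0"] bounds[of 0] 0]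
      unfolding power_0 mult_1_right max.idem .
  next
    case (Suc n)
    have "K / 2 * \<rho> ^ Suc n * s\<^sup>2 = K / 2 * \<rho> ^ n * ((rate + expectation \<tau>) / (1 + rate)) * s\<^sup>2"
      by (simp add: \<rho>_def)
    then show ?case
      using renewal_contraction[OF F F Suc.IH Suc.prems] unfolding F_step[OF Suc.prems] by (simp only:)
  qed
  obtain r G where r: "strict_mono r" and G: "laplace_moment_bounds \<mu> K G"
    and lim: "\<And>s. 0 \<le> s \<Longrightarrow> (\<lambda>n. laplace_stieltjes (F (r n)) s) \<longlonglongrightarrow> laplace_stieltjes G s"
    by (rule laplace_bounds_compact[of \<mu> K F, OF bounds]) (rule that)
  have "renewal (laplace_stieltjes G) s = laplace_stieltjes G s" if s: "0 \<le> s" for s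
  proof -
    have "(\<lambda>n. renewal (laplace_stieltjes (F (r n))) s - laplace_stieltjes (F (r n)) s)
        \<longlonglongrightarrow> renewal (laplace_stieltjes G) s - laplace_stieltjes G s"
      by (intro tendsto_diff renewal_continuous F laplace_moment_boundsD(1)[OF G] lim s)
    moreover have "(\<lambda>n. renewal (laplace_stieltjes (F (r n))) s - laplace_stieltjes (F (r n)) s) \<longlonglongrightarrow> 0"
    proof (rule Lim_null_comparison)
      show "\<forall>\<^sub>F n in sequentially. norm (renewal (laplace_stieltjes (F (r n))) s
          - laplace_stieltjes (F (r n)) s) \<le> K / 2 * \<rho> ^ r n * s\<^sup>2"
        using diff[OF s] unfolding F_step[OF s] real_norm_def by (intro always_eventually allI)
      have "(\<lambda>n. \<rho> ^ r n) \<longlonglongrightarrow> 0"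
        using LIMSEQ_subseq_LIMSEQ[OF LIMSEQ_power_zero r, of \<rho>] rho by (simp add: comp_def)
      then show "(\<lambda>n. K / 2 * \<rho> ^ r n * s\<^sup>2) \<longlonglongrightarrow> 0"
        by (intro tendsto_mult_left_zero tendsto_mult_right_zero)
    qed
    ultimately have "renewal (laplace_stieltjes G) s - laplace_stieltjes G s = 0"
      by (rule LIMSEQ_unique)
    then show ?thesis by simp
  qed
  with G show ?thesis by blast
qed

lemma separated_solution_exists:
  assumes mu: "0 \<le> \<mu>" and m: "expectation \<tau> < 1"
    and K: "2 * \<mu>\<^sup>2 \<le> K * (1 - expectation \<tau>)"
  shows "\<exists>F. laplace_moment_bounds \<mu> K F \<and>
    (\<forall>s\<ge>0. laplace_stieltjes F s *
       (1 + (\<integral>\<omega>. (1 - laplace_stieltjes F (\<tau> \<omega> * s)) / \<tau> \<omega> \<partial>N)) = 1)"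
proof -
  obtain F where F: "laplace_moment_bounds \<mu> K F"
    and fixed: "\<And>s. 0 \<le> s \<Longrightarrow> renewal (laplace_stieltjes F) s = laplace_stieltjes F s"
    using renewal_fixed_point_exists[OF assms] by blast
  have "laplace_stieltjes F s *
       (1 + (\<integral>\<omega>. (1 - laplace_stieltjes F (\<tau> \<omega> * s)) / \<tau> \<omega> \<partial>N)) = 1" if s: "0 \<le> s" for s
  proof -
    have *: "(\<integral>\<omega>. (1 - laplace_stieltjes F (\<tau> \<omega> * s)) / \<tau> \<omega> \<partial>N)
        = rate - (\<integral>\<omega>. laplace_stieltjes F (\<tau> \<omega> * s) / \<tau> \<omega> \<partial>N)"
      unfolding diff_divide_distrib rate_def
      by (rule Bochner_Integration.integral_diff[OF inverse_integrable])
        (rule weighted_integrable[OF laplace_moment_boundsD(1)[OF F] s])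
    have **: "1 + laplace_stieltjes F s * (\<integral>\<omega>. laplace_stieltjes F (\<tau> \<omega> * s) / \<tau> \<omega> \<partial>N)
        = laplace_stieltjes F s * (1 + rate)"
      using fixed[OF s] rate_pos by (simp add: renewal_def divide_eq_eq)
    have rearrange: "a * (1 + (r - i)) = 1" if "1 + a * i = a * (1 + r)" for a i r :: real
      using that by (simp add: algebra_simps)
    show ?thesis unfolding * by (rule rearrange[OF **])
  qed
  with F show ?thesis by blast
qed

end

section \<open>The integrand of \<open>sigma\<close>\<close>

definition sigma_integrand :: "real measure \<Rightarrow> real \<Rightarrow> real \<Rightarrow> real" where
  "sigma_integrand F s t =
     (if t = 0 then (\<integral>x. x \<partial>F) * s else (1 - laplace_stieltjes F (t * s)) / t)"

lemma sigma_eq_integral: "sigma FT F s = (\<integral>t. sigma_integrand F s t \<partial>FT)"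
  by (simp add: sigma_def sigma_integrand_def)

lemma sigma_integrand_bounds:
  assumes F: "laplace_moment_bounds \<mu> K F" and s: "0 \<le> s" and t: "0 \<le> t"
  shows "0 \<le> sigma_integrand F s t" "sigma_integrand F s t \<le> \<mu> * s"
    and "\<mu> * s - sigma_integrand F s t \<le> K / 2 * s\<^sup>2 * t"
proof -
  have mu: "0 \<le> \<mu>" by (rule laplace_bounds_mean_nonneg[OF F])
  show "0 \<le> sigma_integrand F s t" "sigma_integrand F s t \<le> \<mu> * s"
    using one_minus_laplace_le[OF F, of "t * s"] mu s t laplace_bounds_imp_mean(2)[OF F]
    by (auto simp: sigma_integrand_def pos_divide_le_eq mult_ac)
  show "\<mu> * s - sigma_integrand F s t \<le> K / 2 * s\<^sup>2 * t"
  proof (cases "t = 0")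
    case False
    with t have t': "0 < t" by simp
    have "(\<mu> * s - K / 2 * s\<^sup>2 * t) * t \<le> 1 - laplace_stieltjes F (t * s)"
      using t laplace_moment_boundsD(3)[OF F, of "t * s"] s
      by (simp add: algebra_simps power2_eq_square)
    then have "\<mu> * s - K / 2 * s\<^sup>2 * t \<le> (1 - laplace_stieltjes F (t * s)) / t"
      by (simp only: pos_le_divide_eq[OF t'])
    moreover have "sigma_integrand F s t = (1 - laplace_stieltjes F (t * s)) / t"
      using False by (simp add: sigma_integrand_def)
    ultimately show ?thesis by linarith
  qed (use laplace_bounds_imp_mean(2)[OF F] in \<open>simp add: sigma_integrand_def\<close>)
qed

lemma sigma_integrand_measurable:
  assumes "nonneg_distribution F"
  shows "sigma_integrand F s \<in> borel_measurable borel"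
  using laplace_measurable[OF assms] unfolding sigma_integrand_def by measurable

lemma sigma_integrand_integrable:
  assumes FT: "nonneg_distribution FT" and F: "laplace_moment_bounds \<mu> K F" and s: "0 \<le> s"
  shows "integrable FT (sigma_integrand F s)"
proof -
  interpret real_distribution FT using nonneg_distributionD[OF FT] by simp
  note [measurable] = sigma_integrand_measurable[OF laplace_moment_boundsD(1)[OF F]]
  have "AE t in FT. norm (sigma_integrand F s t) \<le> \<mu> * s"
    using nonneg_distributionD(2)[OF FT]
    by eventually_elim (use sigma_integrand_bounds[OF F s] in auto)
  then show ?thesis by (rule integrable_const_bound) measurable
qed

lemma sigma_nonneg:
  assumes FT: "nonneg_distribution FT" and F: "laplace_moment_bounds \<mu> K F" and s: "0 \<le> s"
  shows "0 \<le> sigma FT F s"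
  unfolding sigma_eq_integral
  by (intro integral_nonneg_AE)
    (use nonneg_distributionD(2)[OF FT] in \<open>eventually_elim, use sigma_integrand_bounds[OF F s] in simp\<close>)

section \<open>Existence for general scales\<close>

text \<open>
  Truncate \<open>T\<close> from below at \<open>\<epsilon> n\<close>, solve, and let \<open>\<epsilon> n\<close> tend to \<open>0\<close>. The means of the truncated
  scales stay below \<open>(1 + E T) / 2 < 1\<close>, so that one constant \<open>K\<close> serves for all of them and a limit
  point exists. Pointwise convergence of the integrands under the bound \<open>\<mu> * s\<close> gives the
  equation in the limit; at \<open>t = 0\<close> the truncated integrand is a difference quotient at \<open>\<epsilon> n\<close>, and the
  uniform second-order bound makes it tend to \<open>\<mu> * s\<close>.
\<close>

lemma solution_exists:
  assumes FT: "nonneg_distribution FT" and int: "integrable FT (\<lambda>t. t)"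
    and less_1: "(\<integral>t. t \<partial>FT) < 1" and mu: "0 \<le> \<mu>"
  shows "\<exists>K F. laplace_moment_bounds \<mu> K F \<and>
    (\<forall>s\<ge>0. laplace_stieltjes F s * (1 + sigma FT F s) = 1)"
proof -
  interpret FT: real_distribution FT using nonneg_distributionD[OF FT] by simp
  note pos = nonneg_distributionD(2)[OF FT]
  define m where "m = (\<integral>t. t \<partial>FT)"
  have m: "0 \<le> m" "m < 1"
    using integral_nonneg_AE[OF pos] less_1 by (auto simp: m_def)
  \<comment> \<open>The bound \<open>(1 - m) / 2\<close> keeps the mean of the truncated scale at most \<open>(1 + m) / 2\<close>,
    and \<open>K\<close> solves \<open>K * (1 - (1 + m) / 2) = 2 * \<mu>\<^sup>2\<close>.\<close>
  define \<epsilon> :: "nat \<Rightarrow> real" where "\<epsilon> n = (1 - m) / 2 / (real n + 1)" for n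
  have eps_pos: "0 < \<epsilon> n" for n using m by (simp add: \<epsilon>_def)
  have eps_le: "\<epsilon> n \<le> (1 - m) / 2" for n
  proof -
    have "(1 - m) / 2 / (real n + 1) \<le> (1 - m) / 2 / 1"
      using m by (intro divide_left_mono) auto
    then show ?thesis by (simp add: \<epsilon>_def)
  qed
  have eps_lim: "\<epsilon> \<longlonglongrightarrow> 0" unfolding \<epsilon>_def by real_asymp
  define \<tau> where "\<tau> n t = max (\<epsilon> n) t" for n t
  define K where "K = 4 * \<mu>\<^sup>2 / (1 - m)"
  have int_tau: "integrable FT (\<tau> n)" for n
    unfolding \<tau>_def using int by (intro integrable_max) auto
  have mean_tau: "(\<integral>t. \<tau> n t \<partial>FT) \<le> (1 + m) / 2" for n
  proof -
    have "(\<integral>t. \<tau> n t \<partial>FT) \<le> (\<integral>t. \<epsilon> n + t \<partial>FT)"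
    proof (rule integral_mono_AE[OF int_tau])
      show "AE t in FT. \<tau> n t \<le> \<epsilon> n + t"
        using pos by eventually_elim (use eps_pos[of n] in \<open>simp add: \<tau>_def\<close>)
    qed (use int in simp)
    also have "\<dots> = \<epsilon> n + m" using int FT.prob_space by (simp add: m_def)
    finally show ?thesis using eps_le[of n] by (simp add: field_simps)
  qed
  have scale: "separated_scale FT (\<tau> n) (\<epsilon> n)" for n
    using int_tau[of n] eps_pos[of n]
    by unfold_locales (auto simp: \<tau>_def)
  have tau_measurable [measurable]: "\<tau> n \<in> borel_measurable borel" for n
    unfolding \<tau>_def by measurable
  define solves where "solves n F \<longleftrightarrow> laplace_moment_bounds \<mu> K F \<and> (\<forall>s\<ge>0. laplace_stieltjes F s *
       (1 + (\<integral>t. (1 - laplace_stieltjes F (\<tau> n t * s)) / \<tau> n t \<partial>FT)) = 1)" for n F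
  have "\<exists>F. solves n F" for n
    unfolding solves_def
  proof (rule separated_scale.separated_solution_exists[OF scale mu])
    show "(\<integral>t. \<tau> n t \<partial>FT) < 1" using mean_tau[of n] m by simp
    have "K * (1 - (1 + m) / 2) \<le> K * (1 - (\<integral>t. \<tau> n t \<partial>FT))"
      using mean_tau[of n] m by (intro mult_left_mono) (auto simp: K_def)
    moreover have "K * (1 - (1 + m) / 2) = 2 * \<mu>\<^sup>2"
      using m by (simp add: K_def field_simps)
    ultimately show "2 * \<mu>\<^sup>2 \<le> K * (1 - (\<integral>t. \<tau> n t \<partial>FT))" by simp
  qed
  then obtain F where F: "\<And>n. solves n (F n)" by metis
  have bounds: "laplace_moment_bounds \<mu> K (F n)" for n
    using F[of n] unfolding solves_def by (rule conjunct1)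
  have eqn: "laplace_stieltjes (F n) s *
       (1 + (\<integral>t. (1 - laplace_stieltjes (F n) (\<tau> n t * s)) / \<tau> n t \<partial>FT)) = 1"
    if "0 \<le> s" for n s
    using F[of n] that unfolding solves_def by simp
  obtain r G where r: "strict_mono r" and G: "laplace_moment_bounds \<mu> K G"
    and lim: "\<And>s. 0 \<le> s \<Longrightarrow> (\<lambda>n. laplace_stieltjes (F (r n)) s) \<longlonglongrightarrow> laplace_stieltjes G s"
    by (rule laplace_bounds_compact[of \<mu> K F, OF bounds]) (rule that)
  have eps_r: "(\<lambda>n. \<epsilon> (r n)) \<longlonglongrightarrow> 0"
    using LIMSEQ_subseq_LIMSEQ[OF eps_lim r] by (simp add: comp_def)
  note F' = laplace_moment_boundsD(1)[OF bounds] and G' = laplace_moment_boundsD(1)[OF G]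
  note [measurable] = laplace_measurable[OF F'] sigma_integrand_measurable[OF G']
  have "laplace_stieltjes G s * (1 + sigma FT G s) = 1" if s: "0 \<le> s" for s
  proof -
    let ?k = "\<lambda>n t. (1 - laplace_stieltjes (F n) (\<tau> n t * s)) / \<tau> n t"
    have k_eq: "?k n t = sigma_integrand (F n) s (\<tau> n t)" for n t
      using eps_pos[of n] by (auto simp: sigma_integrand_def \<tau>_def)
    have "(\<lambda>n. \<integral>t. ?k (r n) t \<partial>FT) \<longlonglongrightarrow> (\<integral>t. sigma_integrand G s t \<partial>FT)"
    proof (rule integral_dominated_convergence)
      show "AE t in FT. (\<lambda>n. ?k (r n) t) \<longlonglongrightarrow> sigma_integrand G s t"
        using pos
      proof eventually_elim
        fix t :: real assume t: "0 \<le> t"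
        show "(\<lambda>n. ?k (r n) t) \<longlonglongrightarrow> sigma_integrand G s t"
        proof (cases "t = 0")
          case True
          have tau: "\<tau> n t = \<epsilon> n" for n using True eps_pos[of n] by (simp add: \<tau>_def)
          have "(\<lambda>n. ?k (r n) t) \<longlonglongrightarrow> \<mu> * s"
          proof (rule tendsto_sandwich)
            show "\<forall>\<^sub>F n in sequentially. \<mu> * s - K / 2 * s\<^sup>2 * \<epsilon> (r n) \<le> ?k (r n) t"
            proof (intro always_eventually allI)
              fix n
              show "\<mu> * s - K / 2 * s\<^sup>2 * \<epsilon> (r n) \<le> ?k (r n) t"
                using sigma_integrand_bounds(3)[OF bounds s less_imp_le[OF eps_pos], of "r n" "r n"]
                unfolding k_eq unfolding tau by linarith
            qed
            show "\<forall>\<^sub>F n in sequentially. ?k (r n) t \<le> \<mu> * s"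
              unfolding k_eq unfolding tau
              by (intro always_eventually allI sigma_integrand_bounds(2)[OF bounds s less_imp_le[OF eps_pos]])
            have "(\<lambda>n. \<mu> * s - K / 2 * s\<^sup>2 * \<epsilon> (r n)) \<longlonglongrightarrow> \<mu> * s - K / 2 * s\<^sup>2 * 0"
              by (intro tendsto_intros eps_r)
            then show "(\<lambda>n. \<mu> * s - K / 2 * s\<^sup>2 * \<epsilon> (r n)) \<longlonglongrightarrow> \<mu> * s" by simp
          qed simp
          then show ?thesis
            using True laplace_bounds_imp_mean(2)[OF G] by (simp add: sigma_integrand_def)
        next
          case False
          with t have t': "0 < t" by simp
          have "0 \<le> t * s" using t s by simp
          then have "(\<lambda>n. (1 - laplace_stieltjes (F (r n)) (t * s)) / t)
              \<longlonglongrightarrow> (1 - laplace_stieltjes G (t * s)) / t"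
            using t' by (intro tendsto_intros lim) auto
          moreover have "\<forall>\<^sub>F n in sequentially. (1 - laplace_stieltjes (F (r n)) (t * s)) / t = ?k (r n) t"
            using order_tendstoD(2)[OF eps_r t'] by eventually_elim (simp add: \<tau>_def max_def)
          ultimately have "(\<lambda>n. ?k (r n) t) \<longlonglongrightarrow> (1 - laplace_stieltjes G (t * s)) / t"
            by (rule Lim_transform_eventually)
          then show ?thesis using t' by (simp add: sigma_integrand_def)
        qed
      qed
      show "AE t in FT. norm (?k (r n) t) \<le> \<mu> * s" for n
        unfolding k_eq
      proof (intro always_eventually allI)
        fix t
        have "0 \<le> \<tau> (r n) t" using eps_pos[of "r n"] by (simp add: \<tau>_def)
        then show "norm (sigma_integrand (F (r n)) s (\<tau> (r n) t)) \<le> \<mu> * s"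
          using sigma_integrand_bounds(1,2)[OF bounds s] by simp
      qed
      show "sigma_integrand G s \<in> borel_measurable FT" by measurable
      show "(\<lambda>t. ?k (r n) t) \<in> borel_measurable FT" for n by measurable
    qed simp
    then have "(\<lambda>n. laplace_stieltjes (F (r n)) s * (1 + (\<integral>t. ?k (r n) t \<partial>FT)))
        \<longlonglongrightarrow> laplace_stieltjes G s * (1 + sigma FT G s)"
      unfolding sigma_eq_integral by (intro tendsto_intros lim s)
    then show ?thesis unfolding eqn[OF s] by (simp add: LIMSEQ_const_iff)
  qed
  with G show ?thesis by blast
qed

section \<open>Uniqueness, the moment identity, and the characterisation\<close>

lemma is_solution_iff:
  assumes FT: "nonneg_distribution FT"
  shows "is_solution FT \<mu> F \<longleftrightarrow>
    (\<exists>K. laplace_moment_bounds \<mu> K F) \<and>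
    (\<forall>s\<ge>0. laplace_stieltjes F s * (1 + sigma FT F s) = 1)"
    (is "?sol \<longleftrightarrow> ?bounds \<and> ?eqn")
proof -
  have variance_iff: "finite_variance F \<longleftrightarrow> integrable F (\<lambda>x. x\<^sup>2)"
    if F: "nonneg_distribution F" and int: "integrable F (\<lambda>x. x)"
  proof -
    interpret real_distribution F using nonneg_distributionD[OF F] by simp
    define c where "c = expectation (\<lambda>x. x)"
    have lin: "integrable F (\<lambda>x. c\<^sup>2 - 2 * x * c)" using int by simp
    have "(x - c)\<^sup>2 = x\<^sup>2 + (c\<^sup>2 - 2 * x * c)" for x by (simp add: power2_diff)
    moreover have "integrable F (\<lambda>x. x\<^sup>2 + (c\<^sup>2 - 2 * x * c)) \<longleftrightarrow> integrable F (\<lambda>x. x\<^sup>2)"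
      using lin Bochner_Integration.integrable_diff[OF _ lin, of "\<lambda>x. x\<^sup>2 + (c\<^sup>2 - 2 * x * c)"]
      by auto
    ultimately show ?thesis by (simp add: finite_variance_def c_def)
  qed
  have moments: "nonneg_distribution F \<and> has_mean F \<mu> \<and> finite_variance F \<longleftrightarrow> ?bounds"
  proof
    assume *: "nonneg_distribution F \<and> has_mean F \<mu> \<and> finite_variance F"
    then have "integrable F (\<lambda>x. x)" "(\<integral>x. x \<partial>F) = \<mu>" by (auto simp: has_mean_def)
    then show ?bounds
      using * moments_imp_laplace_bounds[of F] variance_iff by blast
  next
    assume ?bounds
    then obtain K where K: "laplace_moment_bounds \<mu> K F" by blast
    show "nonneg_distribution F \<and> has_mean F \<mu> \<and> finite_variance F"
      using laplace_moment_boundsD(1)[OF K] laplace_bounds_imp_mean[OF K]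
        laplace_bounds_imp_second_moment[OF K] variance_iff
      by (auto simp: has_mean_def)
  qed
  have "(laplace_stieltjes F s = 1 / (1 + sigma FT F s)) \<longleftrightarrow>
      laplace_stieltjes F s * (1 + sigma FT F s) = 1" if ?bounds "0 \<le> s" for s
  proof -
    have "1 + sigma FT F s \<noteq> 0" using sigma_nonneg[OF FT _ that(2)] that(1) by fastforce
    then show ?thesis by (simp add: eq_divide_eq)
  qed
  with moments show ?thesis unfolding is_solution_def by blast
qed

text \<open>
  If the transforms of two solutions differ by at most \<open>D * s\<^sup>2\<close>, the integrands of \<open>sigma\<close> differ by at
  most \<open>D * s\<^sup>2 * t\<close>, and \<open>\<sigma> \<mapsto> 1 / (1 + \<sigma>)\<close> does not increase distances on \<open>\<sigma> \<ge> 0\<close>; hence \<open>D\<close> may be replaced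
  by \<open>D * E T\<close>, and repeatedly so.
\<close>

lemma solution_unique:
  assumes FT: "nonneg_distribution FT" and int: "integrable FT (\<lambda>t. t)"
    and less_1: "(\<integral>t. t \<partial>FT) < 1"
    and F: "is_solution FT \<mu> F" and G: "is_solution FT \<mu> G"
  shows "F = G"
proof -
  interpret FT: real_distribution FT using nonneg_distributionD[OF FT] by simp
  note pos = nonneg_distributionD(2)[OF FT]
  obtain K where K: "laplace_moment_bounds \<mu> K F" using F is_solution_iff[OF FT] by blast
  obtain L where L: "laplace_moment_bounds \<mu> L G" using G is_solution_iff[OF FT] by blast
  note F' = laplace_moment_boundsD(1)[OF K] and G' = laplace_moment_boundsD(1)[OF L]
  define m where "m = (\<integral>t. t \<partial>FT)"
  have m: "0 \<le> m" "m < 1" using integral_nonneg_AE[OF pos] less_1 by (auto simp: m_def)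
  let ?d = "\<lambda>s. \<bar>laplace_stieltjes F s - laplace_stieltjes G s\<bar>"
  define C where "C = max K L / 2"
  have improve: "?d s \<le> D * m * s\<^sup>2" if D: "\<And>s. 0 \<le> s \<Longrightarrow> ?d s \<le> D * s\<^sup>2" and s: "0 \<le> s" for D s
  proof -
    have integrand: "\<bar>sigma_integrand F s t - sigma_integrand G s t\<bar> \<le> D * s\<^sup>2 * t" if t: "0 \<le> t" for t
    proof (cases "t = 0")
      case True
      then show ?thesis
        using laplace_bounds_imp_mean(2)[OF K] laplace_bounds_imp_mean(2)[OF L]
        by (simp add: sigma_integrand_def)
    next
      case False
      with t have t': "0 < t" by simp
      have "?d (t * s) \<le> D * s\<^sup>2 * t * t"
        using D[of "t * s"] t s by (simp add: power2_eq_square mult_ac)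
      from divide_right_mono[OF this t] show ?thesis
        using t' by (simp add: sigma_integrand_def abs_minus_commute flip: diff_divide_distrib)
    qed
    have "\<bar>sigma FT F s - sigma FT G s\<bar> = \<bar>\<integral>t. sigma_integrand F s t - sigma_integrand G s t \<partial>FT\<bar>"
      unfolding sigma_eq_integral
      using sigma_integrand_integrable[OF FT K s] sigma_integrand_integrable[OF FT L s] by simp
    also have "\<dots> \<le> (\<integral>t. \<bar>sigma_integrand F s t - sigma_integrand G s t\<bar> \<partial>FT)"
      by (rule integral_abs_bound)
    also have "\<dots> \<le> (\<integral>t. D * s\<^sup>2 * t \<partial>FT)"
    proof (rule integral_mono_AE)
      show "AE t in FT. \<bar>sigma_integrand F s t - sigma_integrand G s t\<bar> \<le> D * s\<^sup>2 * t"
        using pos by eventually_elim (rule integrand)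
    qed (use int sigma_integrand_integrable[OF FT K s] sigma_integrand_integrable[OF FT L s] in auto)
    also have "\<dots> = D * m * s\<^sup>2" by (simp add: m_def)
    finally have sigma: "\<bar>sigma FT F s - sigma FT G s\<bar> \<le> D * m * s\<^sup>2" .
    have "laplace_stieltjes F s * (1 + sigma FT F s) = 1" "laplace_stieltjes G s * (1 + sigma FT G s) = 1"
      using F G s by (auto simp: is_solution_iff[OF FT])
    moreover have "a - b = a * b * (y - x)" if "a * (1 + x) = 1" "b * (1 + y) = 1" for a b x y :: real
      using that by algebra
    ultimately have "laplace_stieltjes F s - laplace_stieltjes G s =
        laplace_stieltjes F s * laplace_stieltjes G s * (sigma FT G s - sigma FT F s)"
      by blast
    then have "?d s = laplace_stieltjes F s * laplace_stieltjes G s * \<bar>sigma FT F s - sigma FT G s\<bar>"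
      using laplace_nonneg by (simp add: abs_mult abs_minus_commute)
    also have "\<dots> \<le> 1 * \<bar>sigma FT F s - sigma FT G s\<bar>"
      using laplace_le_1[OF F' s] laplace_le_1[OF G' s] laplace_nonneg
      by (intro mult_right_mono mult_le_one) auto
    finally show ?thesis using sigma by simp
  qed
  have iterate: "?d s \<le> C * m ^ n * s\<^sup>2" if "0 \<le> s" for n s
    using that
  proof (induction n arbitrary: s)
    case 0
    then show ?case using laplace_difference_le[OF K L 0] by (simp add: C_def)
  next
    case (Suc n)
    then show ?case using improve[OF Suc.IH Suc.prems] by (simp add: mult_ac)
  qed
  show ?thesis
  proof (rule laplace_eq_imp_eq[OF F' G'])
    fix s :: real assume s: "0 \<le> s"
    have "(\<lambda>n. C * m ^ n * s\<^sup>2) \<longlonglongrightarrow> C * 0 * s\<^sup>2"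
      by (intro tendsto_intros LIMSEQ_power_zero) (use m in simp)
    then have "?d s \<le> C * 0 * s\<^sup>2"
      by (rule LIMSEQ_le_const) (use iterate[OF s] in blast)
    then show "laplace_stieltjes F s = laplace_stieltjes G s" by simp
  qed
qed

text \<open>
  Compare second-order expansions at \<open>0\<close>. Rewriting the equation as \<open>\<phi> - 1 = - \<sigma> + \<sigma> * (1 - \<phi>)\<close> and
  dividing by \<open>u\<^sup>2\<close> gives
  \<open>(\<phi> u - 1 + \<mu> * u) / u\<^sup>2 = (\<mu> * u - \<sigma> u) / u\<^sup>2 + (\<sigma> u / u) * ((1 - \<phi> u) / u)\<close>.
  With \<open>K = E X\<^sup>2\<close> the left-hand side tends to \<open>K / 2\<close>, the last product to \<open>\<mu>\<^sup>2\<close>, and the middle term is the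
  integral of a nonnegative function of \<open>t\<close> tending to \<open>K / 2 * t\<close>. As the middle term is bounded by \<open>K / 2\<close>,
  Fatou's lemma yields \<open>E T < \<infinity>\<close>, and then \<open>K / 2 = K / 2 * E T + \<mu>\<^sup>2\<close>.
\<close>

lemma solution_moment_identity:
  assumes FT: "nonneg_distribution FT" and mu: "0 < \<mu>" and sol: "is_solution FT \<mu> F"
  shows "integrable FT (\<lambda>t. t)"
    and "(\<integral>x. x\<^sup>2 \<partial>F) * (1 - (\<integral>t. t \<partial>FT)) = 2 * \<mu>\<^sup>2"
proof -
  interpret FT: real_distribution FT using nonneg_distributionD[OF FT] by simp
  note pos = nonneg_distributionD(2)[OF FT]
  obtain K' where K': "laplace_moment_bounds \<mu> K' F" using sol is_solution_iff[OF FT] by blast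
  note F = laplace_moment_boundsD(1)[OF K'] and mean = laplace_bounds_imp_mean[OF K']
  note int2 = laplace_bounds_imp_second_moment[OF K']
  interpret F: real_distribution F using nonneg_distributionD[OF F] by simp
  define K where "K = (\<integral>x. x\<^sup>2 \<partial>F)"
  have K: "laplace_moment_bounds \<mu> K F"
    using moments_imp_laplace_bounds[OF F mean(1) int2] by (simp add: mean(2) K_def)
  have eqn: "laplace_stieltjes F s * (1 + sigma FT F s) = 1" if "0 \<le> s" for s
    using sol that is_solution_iff[OF FT] by blast
  have "K = F.variance (\<lambda>x. x) + \<mu>\<^sup>2"
    using F.variance_eq[OF mean(1) int2] mean(2) by (simp add: K_def)
  then have K_pos: "0 < K" using F.variance_positive[of "\<lambda>x. x"] mu by (simp add: add_nonneg_pos)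
  define u :: "nat \<Rightarrow> real" where "u n = 1 / (real n + 1)" for n
  have u_pos: "0 < u n" for n by (simp add: u_def)
  have u_nonneg: "0 \<le> u n" for n using u_pos[of n] by simp
  have u_lim: "u \<longlonglongrightarrow> 0" unfolding u_def by real_asymp
  define curv where "curv s = (laplace_stieltjes F s - 1 + s * \<mu>) / s\<^sup>2" for s
  have curv_lim: "(\<lambda>n. curv (v n)) \<longlonglongrightarrow> K / 2" if "\<And>n. 0 < v n" "v \<longlonglongrightarrow> 0" for v
    using laplace_curvature_limit[OF F mean(1) int2 that] by (simp add: curv_def mean(2) K_def)
  have curv_le: "curv s \<le> K / 2" if "0 < s" for s
    using laplace_moment_boundsD(3)[OF K, of s] that by (simp add: curv_def pos_divide_le_eq mult.commute)
  let ?g = "\<lambda>n t. (\<mu> * u n - sigma_integrand F (u n) t) / (u n)\<^sup>2"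
  have g_int: "integrable FT (?g n)" for n
    using sigma_integrand_integrable[OF FT K u_nonneg[of n]] by simp
  have g_val: "(\<integral>t. ?g n t \<partial>FT) = (\<mu> * u n - sigma FT F (u n)) / (u n)\<^sup>2" for n
    unfolding sigma_eq_integral
    using sigma_integrand_integrable[OF FT K u_nonneg[of n]] FT.prob_space by simp
  have g_nonneg: "AE t in FT. 0 \<le> ?g n t" for n
    using pos by eventually_elim (use sigma_integrand_bounds(2)[OF K u_nonneg[of n]] in simp)
  have g_le: "AE t in FT. norm (?g n t) \<le> K / 2 * t" for n
    using pos g_nonneg[of n]
  proof eventually_elim
    fix t assume "0 \<le> t" and nonneg: "0 \<le> ?g n t"
    then have "\<mu> * u n - sigma_integrand F (u n) t \<le> K / 2 * t * (u n)\<^sup>2"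
      using sigma_integrand_bounds(3)[OF K u_nonneg[of n], of t] by (simp add: mult_ac)
    then have "?g n t \<le> K / 2 * t" using u_pos[of n] by (simp add: pos_divide_le_eq)
    then show "norm (?g n t) \<le> K / 2 * t"
      unfolding real_norm_def abs_of_nonneg[OF nonneg] .
  qed
  have g_lim: "AE t in FT. (\<lambda>n. ?g n t) \<longlonglongrightarrow> K / 2 * t"
    using pos
  proof eventually_elim
    fix t :: real assume t: "0 \<le> t"
    show "(\<lambda>n. ?g n t) \<longlonglongrightarrow> K / 2 * t"
    proof (cases "t = 0")
      case True
      then show ?thesis by (simp add: sigma_integrand_def mean(2))
    next
      case False
      with t have t': "0 < t" by simp
      have g_eq: "?g n t = curv (t * u n) * t" for n
        using t' u_pos[of n] by (simp add: sigma_integrand_def curv_def field_simps power2_eq_square)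
      have "(\<lambda>n. t * u n) \<longlonglongrightarrow> 0" using u_lim by (rule tendsto_mult_right_zero)
      then have "(\<lambda>n. curv (t * u n)) \<longlonglongrightarrow> K / 2" by (rule curv_lim[rotated]) (simp add: t' u_pos)
      then show ?thesis unfolding g_eq by (rule tendsto_mult_right)
    qed
  qed
  define slope where "slope n = (1 - laplace_stieltjes F (u n)) / u n" for n
  have phi_pos: "0 < laplace_stieltjes F (u n)" for n
    using eqn[OF u_nonneg[of n]] laplace_nonneg[of F "u n"] by (cases "laplace_stieltjes F (u n) = 0") auto
  \<comment> \<open>Here \<open>\<sigma> u\<close> has been eliminated from the product by \<open>\<sigma> = (1 - \<phi>) / \<phi>\<close>.\<close>
  have balance: "curv (u n) = (\<integral>t. ?g n t \<partial>FT) + (slope n)\<^sup>2 / laplace_stieltjes F (u n)" for n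
  proof -
    have sigma_eq: "sigma FT F (u n) = (1 - laplace_stieltjes F (u n)) / laplace_stieltjes F (u n)"
      using eqn[OF u_nonneg[of n]] phi_pos[of n] by (simp add: field_simps)
    show ?thesis
      unfolding g_val curv_def slope_def sigma_eq using u_pos[of n] phi_pos[of n]
      by (simp add: field_simps power2_eq_square)
  qed
  have "(\<integral>t. ?g n t \<partial>FT) \<le> K / 2" for n
    using balance[of n] curv_le[OF u_pos[of n]] phi_pos[of n] zero_le_power2[of "slope n"]
    by (smt (verit) divide_nonneg_pos)
  then have int_scaled: "integrable FT (\<lambda>t. K / 2 * t)"
    by (rule Fatou_bound(1)[OF g_lim g_nonneg g_int]) measurable
  from integrable_mult_right[OF this, of "2 / K"] show "integrable FT (\<lambda>t. t)"
    using K_pos by simp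
  have g_conv: "(\<lambda>n. \<integral>t. ?g n t \<partial>FT) \<longlonglongrightarrow> (\<integral>t. K / 2 * t \<partial>FT)"
    by (rule integral_dominated_convergence[OF _ _ int_scaled g_lim g_le])
      (use borel_measurable_integrable[OF g_int] in auto)
  have slope_eq: "slope = (\<lambda>n. \<mu> - curv (u n) * u n)"
  proof
    show "slope n = \<mu> - curv (u n) * u n" for n
      using u_pos[of n] by (simp add: slope_def curv_def field_simps power2_eq_square)
  qed
  have slope_lim: "slope \<longlonglongrightarrow> \<mu>"
    using tendsto_diff[OF tendsto_const tendsto_mult[OF curv_lim[OF u_pos u_lim] u_lim], of \<mu>]
    unfolding slope_eq by simp
  have phi_eq: "laplace_stieltjes F (u n) = 1 - slope n * u n" for n
    using u_pos[of n] by (simp add: slope_def)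
  have "(\<lambda>n. laplace_stieltjes F (u n)) \<longlonglongrightarrow> 1"
    using tendsto_diff[OF tendsto_const tendsto_mult[OF slope_lim u_lim], of 1]
    unfolding phi_eq by simp
  then have "(\<lambda>n. (slope n)\<^sup>2 / laplace_stieltjes F (u n)) \<longlonglongrightarrow> \<mu>\<^sup>2 / 1"
    by (intro tendsto_intros slope_lim) auto
  with g_conv have "(\<lambda>n. curv (u n)) \<longlonglongrightarrow> (\<integral>t. K / 2 * t \<partial>FT) + \<mu>\<^sup>2 / 1"
    unfolding balance by (rule tendsto_add)
  with curv_lim[OF u_pos u_lim] have "K / 2 = (\<integral>t. K / 2 * t \<partial>FT) + \<mu>\<^sup>2 / 1"
    by (rule LIMSEQ_unique)
  then show "(\<integral>x. x\<^sup>2 \<partial>F) * (1 - (\<integral>t. t \<partial>FT)) = 2 * \<mu>\<^sup>2"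
    by (simp add: K_def[symmetric] algebra_simps)
qed

theorem corollary3:
  fixes \<mu> :: real and M :: "'a measure" and T :: "'a \<Rightarrow> real"
  assumes "0 < \<mu>"
    and "prob_space M"
    and "T \<in> borel_measurable M"
    and "AE \<omega> in M. 0 \<le> T \<omega>"
  shows "((integrable M T \<and> 0 \<le> prob_space.expectation M T \<and> prob_space.expectation M T < 1) \<longleftrightarrow>
            (\<exists>!F. is_solution (distr M borel T) \<mu> F)) \<and>
         ((integrable M T \<and> 0 \<le> prob_space.expectation M T \<and> prob_space.expectation M T < 1) \<longrightarrow>
            (\<forall>F. is_solution (distr M borel T) \<mu> F \<longrightarrow>
               prob_space.variance F (\<lambda>x. x) =
                 (1 + prob_space.expectation M T) / (1 - prob_space.expectation M T) * \<mu>\<^sup>2))"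
proof -
  interpret prob_space M by fact
  note [measurable] = assms(3)
  define FT where "FT = distr M borel T"
  have FT: "nonneg_distribution FT"
    using assms(4) by (auto simp: nonneg_distribution_def FT_def AE_distr_iff)
  have int_iff: "integrable FT (\<lambda>t. t) \<longleftrightarrow> integrable M T"
    by (simp add: FT_def integrable_distr_eq)
  have mean: "(\<integral>t. t \<partial>FT) = expectation T"
    by (simp add: FT_def integral_distr)
  have nonneg: "0 \<le> expectation T" using assms(4) by (rule integral_nonneg_AE)
  have subcritical: "integrable M T \<and> expectation T < 1" if "is_solution FT \<mu> F" for F
  proof -
    note identity = solution_moment_identity[OF FT assms(1) that]
    have "0 < (\<integral>x. x\<^sup>2 \<partial>F) * (1 - expectation T)"
      using identity(2) assms(1) by (simp add: mean)
    moreover have "0 \<le> (\<integral>x. x\<^sup>2 \<partial>F)" by simp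
    ultimately show ?thesis
      using identity(1) by (auto simp: int_iff zero_less_mult_iff)
  qed
  have "\<exists>!F. is_solution FT \<mu> F" if "integrable M T" "expectation T < 1"
  proof (rule ex_ex1I)
    show "\<exists>F. is_solution FT \<mu> F"
      using solution_exists[OF FT, of \<mu>] that assms(1)
      unfolding is_solution_iff[OF FT] int_iff mean by force
    show "F = G" if "is_solution FT \<mu> F" "is_solution FT \<mu> G" for F G
      using solution_unique[OF FT _ _ that] \<open>integrable M T\<close> \<open>expectation T < 1\<close>
      by (simp add: int_iff mean)
  qed
  moreover have "prob_space.variance F (\<lambda>x. x) = (1 + expectation T) / (1 - expectation T) * \<mu>\<^sup>2"
    if less_1: "expectation T < 1" and sol: "is_solution FT \<mu> F" for F
  proof -
    obtain K where K: "laplace_moment_bounds \<mu> K F" using sol is_solution_iff[OF FT] by blast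
    interpret F: real_distribution F
      using nonneg_distributionD laplace_moment_boundsD(1)[OF K] by blast
    have "F.variance (\<lambda>x. x) = (\<integral>x. x\<^sup>2 \<partial>F) - \<mu>\<^sup>2"
      using F.variance_eq[OF laplace_bounds_imp_mean(1)[OF K] laplace_bounds_imp_second_moment[OF K]]
      by (simp add: laplace_bounds_imp_mean(2)[OF K])
    also have "(\<integral>x. x\<^sup>2 \<partial>F) = 2 * \<mu>\<^sup>2 / (1 - expectation T)"
      using solution_moment_identity(2)[OF FT assms(1) sol] less_1
      by (simp add: mean eq_divide_eq)
    also have "2 * \<mu>\<^sup>2 / (1 - expectation T) - \<mu>\<^sup>2 = (1 + expectation T) / (1 - expectation T) * \<mu>\<^sup>2"
      using less_1 by (simp add: field_simps)
    finally show ?thesis .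
  qed
  ultimately show ?thesis
    using subcritical nonneg unfolding FT_def by blast
qed

end
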